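(* Let $t>0$ and choose the pole family $q_m^*=\frac{m}{\sqrt2\,t}$, $m\ge1$. Let $m_\varepsilon^*$ be the first degree $m\ge1$ for which $\mathcal E_m^{\rm rat}(t,q_m^* )\le\varepsilon$, and let $L_\varepsilon=\log(1/\varepsilon)$. Then, as $\varepsilon\downarrow0$, $$m_\varepsilon^*=\frac{L_\varepsilon}{\operatorname{arsinh}(1)}-\frac{\log L_\varepsilon}{2\operatorname{arsinh}(1)}+O(1),$$ and the corresponding pole satisfies $$q_\varepsilon^*:=\frac{m_\varepsilon^*}{\sqrt2\,t}=\frac1{\sqrt2\,t\,\operatorname{arsinh}(1)}\left(L_\varepsilon-\frac12\log L_\varepsilon\right)+O(t^{-1}).$$ Thus the leading number of degrees needed for a prescribed half-line uniform tolerance is independent of $t$, and each additional decimal digit of uniform accuracy costs $\log 10/\operatorname{arsinh}(1)\approx2.6125$ degrees at leading order.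
   Context: For $q>0$ and an integer $m\ge0$, $\mathcal R_m(q)=\left\{\frac{P_m(z)}{(q-z)^m}:\ P_m\text{ a polynomial},\ \deg P_m\le m\right\}$, and for $t>0$, $$\mathcal E_m^{\rm rat}(t,q)=\inf_{r\in\mathcal R_m(q)}\ \sup_{z\le0}|e^{tz}-r(z)|$$ is the best restricted-denominator error. Note $\operatorname{arsinh}(1)=\log(1+\sqrt2)$. "Leading order" refers to the term $L_\varepsilon/\operatorname{arsinh}(1)$ in the expansion of $m_\varepsilon^*$. *)

theory Defs
  imports Complex_Main "HOL-Library.Landau_Symbols" "HOL-Computational_Algebra.Polynomial"
begin

definition restricted_rat :: "nat \<Rightarrow> real \<Rightarrow> (real \<Rightarrow> real) set" where
  "restricted_rat m q = {\<lambda>z. poly P z / (q - z) ^ m | P. degree P \<le> m}"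

text \<open>The supremum and the infimum are taken in \<open>real\<close>. Both are genuine for \<open>q > 0\<close> and
  \<open>t > 0\<close>: the errors are bounded on the half-line, as \<open>bdd_above_rat_error\<close> below shows.\<close>

definition rat_error :: "nat \<Rightarrow> real \<Rightarrow> real \<Rightarrow> real" where
  "rat_error m t q = (INF r\<in>restricted_rat m q. SUP z\<in>{..0}. \<bar>exp (t * z) - r z\<bar>)"

lemma bdd_above_rat_error:
  assumes "q > 0" "t > 0" "r \<in> restricted_rat m q"
  shows "bdd_above ((\<lambda>z. \<bar>exp (t * z) - r z\<bar>) ` {..0})"
proof -
  from assms(3) obtain P where P: "degree P \<le> m" "r = (\<lambda>z. poly P z / (q - z) ^ m)"
    by (auto simp: restricted_rat_def)
  have "\<bar>exp (t * z) - r z\<bar> \<le> 1 + (\<Sum>i\<le>degree P. \<bar>coeff P i\<bar> / q ^ (m - i))"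
    if z: "z \<le> 0" for z
  proof -
    have "\<bar>coeff P i * z ^ i / (q - z) ^ m\<bar> \<le> \<bar>coeff P i\<bar> / q ^ (m - i)"
      if i: "i \<le> degree P" for i
    proof -
      have m: "m = i + (m - i)" using i P by simp
      have "\<bar>z\<bar> ^ i * q ^ (m - i) \<le> (q - z) ^ i * (q - z) ^ (m - i)"
        using assms z by (intro mult_mono power_mono) auto
      also have "\<dots> = (q - z) ^ m"
        using m by (metis power_add)
      finally have "\<bar>z\<bar> ^ i / (q - z) ^ m \<le> 1 / q ^ (m - i)"
        using assms z by (simp add: field_simps)
      from mult_left_mono[OF this, of "\<bar>coeff P i\<bar>"] show ?thesis
        using assms z by (simp add: abs_mult power_abs)
    qed
    then have "\<bar>r z\<bar> \<le> (\<Sum>i\<le>degree P. \<bar>coeff P i\<bar> / q ^ (m - i))"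
      unfolding P(2) poly_altdef sum_divide_distrib
      by (intro order_trans[OF sum_abs] sum_mono) auto
    moreover have "exp (t * z) \<le> 1"
      using assms z by (simp add: mult_nonneg_nonpos)
    moreover have "exp (t * z) > 0" by simp
    ultimately show ?thesis by linarith
  qed
  then show ?thesis by (intro bdd_aboveI2) auto
qed

definition opt_pole :: "nat \<Rightarrow> real \<Rightarrow> real" where
  "opt_pole m t = real m / (sqrt 2 * t)"

definition first_degree :: "real \<Rightarrow> real \<Rightarrow> nat" where
  "first_degree t \<epsilon> = (LEAST m. m \<ge> 1 \<and> rat_error m t (opt_pole m t) \<le> \<epsilon>)"

definition log_tol :: "real \<Rightarrow> real" where
  "log_tol \<epsilon> = ln (1 / \<epsilon>)"

definition leading_degree :: "real \<Rightarrow> real" where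
  "leading_degree \<epsilon> = log_tol \<epsilon> / arsinh 1"

text \<open>The limit \<open>\<epsilon> \<down> 0\<close> uniformly in \<open>t > 0\<close>: a property holds eventually in this filter iff there
  is \<open>\<epsilon>\<^sub>0 > 0\<close> such that it holds for all \<open>t > 0\<close> and all \<open>0 < \<epsilon> < \<epsilon>\<^sub>0\<close>. Hence the constants hidden
  in \<open>O(\<dots>)\<close> along it do not depend on \<open>t\<close>, which is what gives \<open>O(1 / t)\<close> its meaning.\<close>

definition small_tol_unif :: "(real \<times> real) filter" where
  "small_tol_unif = principal {0<..} \<times>\<^sub>F at_right 0"

lemma eventually_small_tol_unif:
  "eventually P small_tol_unif \<longleftrightarrow> (\<exists>\<epsilon>\<^sub>0>0. \<forall>t>0. \<forall>\<epsilon>. 0 < \<epsilon> \<and> \<epsilon> < \<epsilon>\<^sub>0 \<longrightarrow> P (t, \<epsilon>))"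
proof
  assume "eventually P small_tol_unif"
  then obtain Q R where "eventually Q (principal {0<..})" "eventually R (at_right (0::real))"
    and QR: "\<And>x y. Q x \<Longrightarrow> R y \<Longrightarrow> P (x, y)"
    unfolding small_tol_unif_def eventually_prod_filter by blast
  then show "\<exists>\<epsilon>\<^sub>0>0. \<forall>t>0. \<forall>\<epsilon>. 0 < \<epsilon> \<and> \<epsilon> < \<epsilon>\<^sub>0 \<longrightarrow> P (t, \<epsilon>)"
    unfolding eventually_principal eventually_at_right_field by (auto intro!: QR)
next
  assume "\<exists>\<epsilon>\<^sub>0>0. \<forall>t>0. \<forall>\<epsilon>. 0 < \<epsilon> \<and> \<epsilon> < \<epsilon>\<^sub>0 \<longrightarrow> P (t, \<epsilon>)"
  then obtain e where e: "e > 0" "\<And>t \<epsilon>. t > 0 \<Longrightarrow> 0 < \<epsilon> \<Longrightarrow> \<epsilon> < e \<Longrightarrow> P (t, \<epsilon>)" by blast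
  have "eventually (\<lambda>\<epsilon>. 0 < \<epsilon> \<and> \<epsilon> < e) (at_right 0)"
    using e(1) unfolding eventually_at_right_field by auto
  then show "eventually P small_tol_unif"
    unfolding small_tol_unif_def eventually_prod_filter eventually_principal
    by (intro exI[of _ "\<lambda>t. t > 0"] exI[of _ "\<lambda>\<epsilon>. 0 < \<epsilon> \<and> \<epsilon> < e"]) (auto intro: e)
qed

end

theory Submission
  imports Defs "HOL-Probability.Distributions" "HOL-Complex_Analysis.Complex_Analysis"
    "HOL-Real_Asymp.Real_Asymp"
begin

text \<open>With the pole at \<open>q = m / (sqrt 2 * t)\<close> and \<open>z = - q * \<tau>\<^sup>2\<close>, the exponential \<open>exp (t * z)\<close> becomes
\<open>exp (- a * \<tau>\<^sup>2)\<close> with \<open>a = m / sqrt 2\<close>, and the functions in \<open>restricted_rat m q\<close> become the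
polynomials of degree at most \<open>m\<close> in \<open>s = 1 / (1 + \<tau>\<^sup>2)\<close>. So \<open>t\<close> drops out, and the error is that of
best uniform polynomial approximation on \<open>0 < s \<le> 1\<close>. On the circle \<open>v = (1 + i \<tau>) / (1 - i \<tau>)\<close> one
has \<open>s = (1 + Re v) / 2\<close>: the polynomials in \<open>s\<close> are the even trigonometric polynomials in \<open>v\<close>, and
the error is governed by the Fourier coefficients
\<open>\<integral> exp (- a * u\<^sup>2) * ((1 + i u) / (1 - i u)) ^ k * 2 / (1 + u\<^sup>2) du\<close> with \<open>k > m\<close>.

For \<open>k\<close> near \<open>m\<close> the dominant factor is the \<open>m\<close>-th power of
\<open>exp (- u\<^sup>2 / sqrt 2) * (1 + i u) / (1 - i u)\<close>. Its relevant saddle points are \<open>(\<plusminus>1 + i) / sqrt 2\<close>, and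
there its modulus is \<open>rho = sqrt 2 - 1 = exp (- arsinh 1)\<close>. On the horizontal line through the saddle
points the modulus is at most \<open>rho\<close> times a Gaussian around each of them (\<open>norm_saddle_line\<close>), so
that integrals of the \<open>m\<close>-th power over this line have size \<open>rho ^ m / sqrt m\<close>. This is the exact
order of the error, and both bounds are needed up to constant factors only.

\<^item> \<^emph>\<open>Upper bound.\<close> Cauchy's formula on a strip writes \<open>exp (- a * \<tau>\<^sup>2)\<close> as an integral over the line;
  expanding the Cauchy kernel in powers of \<open>w / v\<close>, where \<open>w\<close> is the Cayley transform of the point on
  the line, and keeping the powers up to \<open>m\<close> gives a polynomial in \<open>s\<close> whose error is an integral of
  the above type (\<open>gauss_approx_poly\<close>).

\<^item> \<^emph>\<open>Lower bound.\<close> The powers \<open>v ^ k\<close> with \<open>k > m\<close> are orthogonal to every approximant, so the Fourier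
  coefficients bound the error from below (\<open>cheb_coeff_le_error\<close>). By Laplace's method a coefficient is
  \<open>rho ^ m / sqrt m\<close> times an oscillating factor. Passing from \<open>k = m + 1\<close> to \<open>k = m + 2\<close> multiplies
  the contribution of a saddle point by \<open>i * rho\<close>, so the two factors are never both small
  (\<open>cheb_coeff_lower\<close>). For the finitely many remaining \<open>m\<close> it suffices that the error has a positive
  lower bound independent of \<open>t\<close> (\<open>rat_error_bounded_below\<close>).

Hence \<open>- ln\<close> of the error is \<open>arsinh 1 * m + ln m / 2 + O(1)\<close>, uniformly in \<open>t\<close>, and solving
\<open>arsinh 1 * m + ln m / 2 = L + O(1)\<close> for \<open>m\<close> gives the expansion of the first degree
(\<open>first_degree_expansion\<close>), from which everything else follows.\<close>

section \<open>Integrals along horizontal lines\<close>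

lemma integral_real_line_FTC:
  fixes F f :: "real \<Rightarrow> complex"
  assumes int: "integrable lborel f" and cont: "continuous_on UNIV f"
    and F: "\<And>x. (F has_vector_derivative f x) (at x)"
    and lim: "(\<lambda>n. F (real n) - F (- real n)) \<longlonglongrightarrow> L"
  shows "integral\<^sup>L lborel f = L"
proof -
  have "(\<lambda>n. \<integral>x. indicator {- real n..real n} x *\<^sub>R f x \<partial>lborel) \<longlonglongrightarrow> integral\<^sup>L lborel f"
  proof (rule integral_dominated_convergence[where w = "\<lambda>x. norm (f x)"])
    show "AE x in lborel. (\<lambda>n. indicat_real {- real n..real n} x *\<^sub>R f x) \<longlonglongrightarrow> f x"
    proof (intro AE_I2 tendsto_eventually)
      fix x :: real
      show "\<forall>\<^sub>F n in sequentially. indicat_real {- real n..real n} x *\<^sub>R f x = f x"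
        using eventually_ge_at_top[of "nat \<lceil>\<bar>x\<bar>\<rceil>"]
        by eventually_elim (auto simp: indicator_def)
    qed
  qed (use int in \<open>auto simp: indicator_def\<close>)
  moreover have "(\<integral>x. indicator {- real n..real n} x *\<^sub>R f x \<partial>lborel) = F (real n) - F (- real n)" for n
    by (rule integral_FTC_atLeastAtMost)
       (auto intro: continuous_on_subset[OF cont] has_vector_derivative_at_within F)
  ultimately show ?thesis
    using lim LIMSEQ_unique by simp
qed

text \<open>On the strip \<open>g\<close> has a primitive \<open>H\<close>, and \<open>x \<mapsto> H (x + i y1) - H (x + i y2)\<close> is a primitive of the
integrand that tends to 0 at both ends because \<open>g\<close> decays on the vertical segments. Only the
difference is assumed integrable, which allows a \<open>g\<close> that decays too slowly to be integrable itself;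
the finite set \<open>K\<close> admits removable singularities.\<close>

lemma integral_horizontal_line_shift:
  fixes g :: "complex \<Rightarrow> complex"
  assumes ab: "a < y1" "y1 \<le> y2" "y2 < b" and fin: "finite K"
    and cont: "continuous_on {u. a < Im u \<and> Im u < b} g"
    and diff: "\<And>u. a < Im u \<Longrightarrow> Im u < b \<Longrightarrow> u \<notin> K \<Longrightarrow> g field_differentiable at u"
    and decay: "\<And>x y. R \<le> \<bar>x\<bar> \<Longrightarrow> y1 \<le> y \<Longrightarrow> y \<le> y2 \<Longrightarrow> norm (g (Complex x y)) \<le> C / \<bar>x\<bar>"
    and int: "integrable lborel (\<lambda>x. g (Complex x y1) - g (Complex x y2))"
  shows "(\<integral>x. g (Complex x y1) - g (Complex x y2) \<partial>lborel) = 0"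
proof -
  define S where "S = {u. a < Im u \<and> Im u < b}"
  have S: "S = {u. Im u < b} \<inter> {u. Im u > a}"
    by (auto simp: S_def)
  have "open S" "convex S"
    unfolding S by (auto intro: open_halfspace_Im_lt open_halfspace_Im_gt convex_Int
                      convex_halfspace_Im_lt convex_halfspace_Im_gt)
  obtain H where H: "\<And>u. u \<in> S \<Longrightarrow> (H has_field_derivative g u) (at u within S)"
    using holomorphic_convex_primitive[OF \<open>convex S\<close> fin, of g] cont diff \<open>open S\<close>
    by (auto simp: S_def interior_open)
  then have H: "(H has_field_derivative g u) (at u)" if "u \<in> S" for u
    using that \<open>open S\<close> by (metis at_within_open)
  have line: "((\<lambda>x. Complex x y) has_vector_derivative 1) (at x)" for x y
    unfolding Complex_eq by (auto intro!: derivative_eq_intros)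
  have Hline: "((\<lambda>x. H (Complex x y)) has_vector_derivative g (Complex x y)) (at x)"
    if "a < y" "y < b" for x y
    using field_vector_diff_chain_at[OF line H] that by (auto simp: S_def o_def)
  have cline: "continuous_on UNIV (\<lambda>x. g (Complex x y))" if "a < y" "y < b" for y
    by (rule continuous_on_compose2[OF cont]) (use that in \<open>auto intro!: continuous_intros\<close>)
  have bd: "norm (H (Complex x y1) - H (Complex x y2)) \<le> C / \<bar>x\<bar> * \<bar>y1 - y2\<bar>" if "R \<le> \<bar>x\<bar>" for x
  proof -
    have "closed_segment (Complex x y2) (Complex x y1) = {Complex x y |y. y \<in> closed_segment y2 y1}"
      by (auto simp: closed_segment_def complex_eq_iff algebra_simps intro!: exI)
    then have seg: "closed_segment (Complex x y2) (Complex x y1) = {Complex x y |y. y1 \<le> y \<and> y \<le> y2}"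
      using ab by (auto simp: closed_segment_eq_real_ivl)
    have "norm (H (Complex x y1) - H (Complex x y2)) \<le> C / \<bar>x\<bar> * norm (Complex x y1 - Complex x y2)"
    proof (rule field_differentiable_bound[where S = "closed_segment (Complex x y2) (Complex x y1)"])
      fix u assume "u \<in> closed_segment (Complex x y2) (Complex x y1)"
      then obtain y where "u = Complex x y" "y1 \<le> y" "y \<le> y2" by (auto simp: seg)
      then show "(H has_field_derivative g u) (at u within closed_segment (Complex x y2) (Complex x y1))"
        "norm (g u) \<le> C / \<bar>x\<bar>"
        using ab decay that by (auto intro!: has_field_derivative_at_within H simp: S_def)
    qed auto
    also have "norm (Complex x y1 - Complex x y2) = \<bar>y1 - y2\<bar>"
      by (simp add: cmod_def)
    finally show ?thesis .
  qed
  define F where "F x = H (Complex x y1) - H (Complex x y2)" for x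
  have ev: "\<forall>\<^sub>F n in sequentially. R \<le> real n"
    using eventually_ge_at_top[of "nat \<lceil>R\<rceil>"] by eventually_elim linarith
  have z: "(\<lambda>n. C / \<bar>real n\<bar> * \<bar>y1 - y2\<bar>) \<longlonglongrightarrow> 0"
    using tendsto_mult[OF lim_const_over_n[of C] tendsto_const[of "\<bar>y1 - y2\<bar>"]] by simp
  have F0: "(\<lambda>n. F (c n)) \<longlonglongrightarrow> 0" if c: "\<And>n. \<bar>c n\<bar> = real n" for c
  proof (rule Lim_null_comparison[OF _ z], use ev in eventually_elim)
    fix n assume "R \<le> real n"
    then show "norm (F (c n)) \<le> C / \<bar>real n\<bar> * \<bar>y1 - y2\<bar>"
      using bd[of "c n"] c[of n] by (simp add: F_def)
  qed
  have "(\<lambda>n. F (real n)) \<longlonglongrightarrow> 0" "(\<lambda>n. F (- real n)) \<longlonglongrightarrow> 0"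
    by (auto intro: F0)
  then have "(\<lambda>n. F (real n) - F (- real n)) \<longlonglongrightarrow> 0"
    using tendsto_diff by fastforce
  moreover have "(F has_vector_derivative g (Complex x y1) - g (Complex x y2)) (at x)" for x
    unfolding F_def using ab by (intro has_vector_derivative_diff Hline) auto
  ultimately show ?thesis
    using ab by (intro integral_real_line_FTC[where F = F] int continuous_on_diff cline) auto
qed

section \<open>The Cayley transform and the integrand on the saddle line\<close>

text \<open>Maps the real line to the unit circle and the upper half-plane into the unit disc. If
\<open>cayley \<tau> = exp (i \<theta>)\<close> for a real \<open>\<tau>\<close>, then \<open>\<tau> = tan (\<theta> / 2)\<close> and \<open>d\<theta> = 2 d\<tau> / (1 + \<tau>\<^sup>2)\<close>.\<close>

definition cayley :: "complex \<Rightarrow> complex" where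
  "cayley u = (1 + \<i> * u) / (1 - \<i> * u)"

text \<open>The exponential \<open>exp (t * z)\<close> in the variable \<open>u\<close> with \<open>z = - opt_pole m t * u\<^sup>2\<close>.\<close>

definition gauss :: "nat \<Rightarrow> complex \<Rightarrow> complex" where
  "gauss m u = exp (- of_real (real m / sqrt 2) * u\<^sup>2)"

text \<open>Imaginary part, and absolute value of the real part, of the saddle points \<open>(\<plusminus>1 + i) / sqrt 2\<close> of
\<open>exp (- u\<^sup>2 / sqrt 2) * cayley u\<close> in the upper half-plane.\<close>

definition saddle_im :: real where "saddle_im = sqrt 2 / 2"

definition rho :: real where "rho = sqrt 2 - 1"

lemma rho_pos: "0 < rho"
  by (simp add: rho_def)

lemma saddle_im: "0 < saddle_im" "saddle_im < 1" "saddle_im\<^sup>2 = 1/2"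
  by (auto simp: saddle_im_def power_divide real_less_lsqrt)

lemma rho_eq_exp: "rho = exp (- arsinh 1)"
proof -
  have "exp (arsinh (1::real)) = 1 + sqrt 2"
    by (simp add: arsinh_real_def add_pos_nonneg)
  moreover have "(1 + sqrt 2) * (sqrt 2 - 1) = (1::real)"
    by (simp add: algebra_simps)
  ultimately show ?thesis
    unfolding rho_def exp_minus by (metis inverse_unique)
qed

lemma norm_cayley_num: "(cmod (1 + \<i> * Complex x y))\<^sup>2 = (1 - y)\<^sup>2 + x\<^sup>2"
  by (simp add: cmod_power2)

lemma norm_cayley_den: "(cmod (1 - \<i> * Complex x y))\<^sup>2 = (1 + y)\<^sup>2 + x\<^sup>2"
  by (simp add: cmod_power2)

lemma cayley_factors_nz:
  assumes "- 1 < Im u" "Im u < 1"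
  shows "1 + \<i> * u \<noteq> 0" "1 - \<i> * u \<noteq> 0" "1 + u\<^sup>2 \<noteq> 0"
proof -
  show *: "1 + \<i> * u \<noteq> 0" "1 - \<i> * u \<noteq> 0"
    using assms by (auto simp: complex_eq_iff)
  have "1 + u\<^sup>2 = (1 + \<i> * u) * (1 - \<i> * u)"
    by (simp add: algebra_simps power2_eq_square)
  with * show "1 + u\<^sup>2 \<noteq> 0" by simp
qed

lemma one_plus_square: "1 + u\<^sup>2 = (1 + \<i> * u) * (1 - \<i> * u)" for u :: complex
  by (simp add: algebra_simps power2_eq_square)

lemma has_derivative_cayley:
  assumes "- 1 < Im u" "Im u < 1"
  shows "(cayley has_field_derivative 2 * \<i> * cayley u / (1 + u\<^sup>2)) (at u)"
proof -
  note nz = cayley_factors_nz[OF assms]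
  have "(cayley has_field_derivative
      ((\<i> * (1 - \<i> * u) + \<i> * (1 + \<i> * u)) / (1 - \<i> * u)\<^sup>2)) (at u)"
    unfolding cayley_def using nz
    by (auto intro!: derivative_eq_intros simp: power2_eq_square)
  also have "(\<i> * (1 - \<i> * u) + \<i> * (1 + \<i> * u)) / (1 - \<i> * u)\<^sup>2 = 2 * \<i> / (1 - \<i> * u)\<^sup>2"
    by (simp add: algebra_simps)
  also have "\<dots> = 2 * \<i> * cayley u / (1 + u\<^sup>2)"
    unfolding cayley_def one_plus_square using nz by (simp add: power2_eq_square)
  finally show ?thesis .
qed

lemma norm_cayley_le_1:
  assumes "0 \<le> y"
  shows "cmod (cayley (Complex x y)) \<le> 1"
proof -
  have "(cmod (1 + \<i> * Complex x y))\<^sup>2 \<le> (cmod (1 - \<i> * Complex x y))\<^sup>2"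
    unfolding norm_cayley_num norm_cayley_den using assms by (simp add: power2_eq_square algebra_simps)
  then have "cmod (1 + \<i> * Complex x y) \<le> cmod (1 - \<i> * Complex x y)"
    by (rule power2_le_imp_le) auto
  then show ?thesis
    by (simp add: cayley_def norm_divide divide_le_eq_1)
qed

lemma norm_cayley_over_le:
  assumes "0 \<le> y" "y < 1"
  shows "cmod (cayley (Complex x y) / (1 + (Complex x y)\<^sup>2)) \<le> 1 / (1 + x\<^sup>2)"
proof -
  let ?u = "Complex x y"
  note nz = cayley_factors_nz[of ?u]
  have "cayley ?u / (1 + ?u\<^sup>2) = 1 / (1 - \<i> * ?u)\<^sup>2"
    unfolding cayley_def one_plus_square using nz assms by (simp add: power2_eq_square)
  then have "cmod (cayley ?u / (1 + ?u\<^sup>2)) = 1 / ((1 + y)\<^sup>2 + x\<^sup>2)"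
    by (simp only: norm_divide norm_power norm_one norm_cayley_den)
  also have "\<dots> \<le> 1 / (1 + x\<^sup>2)"
    using assms by (intro divide_left_mono mult_pos_pos add_pos_nonneg add_right_mono)
      (auto simp: power2_eq_square algebra_simps intro!: add_pos_nonneg)
  finally show ?thesis .
qed

text \<open>The second quotient controls the remainder of the geometric series of the Cauchy kernel. It stays
bounded although \<open>norm (cayley u)\<close> tends to 1 along the line: with \<open>N = (norm (1 - i u))\<^sup>2\<close> one has
\<open>norm (1 + u\<^sup>2) = norm (cayley u) * N\<close> and \<open>1 - (norm (cayley u))\<^sup>2 = 4 * y / N\<close>.\<close>

lemma norm_cayley_tail_le:
  assumes "0 < y" "y < 1"
  shows "cmod (cayley (Complex x y)) < 1"
    and "cmod (cayley (Complex x y)) / (cmod (1 + (Complex x y)\<^sup>2) * (1 - cmod (cayley (Complex x y)))) \<le> 1 / (2 * y)"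
proof -
  let ?u = "Complex x y"
  define a where "a = cmod (1 + \<i> * ?u)"
  define b where "b = cmod (1 - \<i> * ?u)"
  have nz: "a > 0" "b > 0"
    using cayley_factors_nz[of ?u] assms by (auto simp: a_def b_def)
  have w: "cmod (cayley ?u) = a / b" by (simp add: cayley_def norm_divide a_def b_def)
  have ab: "b\<^sup>2 - a\<^sup>2 = 4 * y"
    unfolding a_def b_def norm_cayley_num norm_cayley_den by (simp add: power2_eq_square algebra_simps)
  then have "a\<^sup>2 < b\<^sup>2" using assms by simp
  then have lt: "a < b" using nz by (simp add: power_less_imp_less_base)
  then show "cmod (cayley ?u) < 1" using w nz by simp
  have "cmod (cayley ?u) / (cmod (1 + ?u\<^sup>2) * (1 - cmod (cayley ?u))) = 1 / (b * (b - a))"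
    unfolding w one_plus_square norm_mult a_def[symmetric] b_def[symmetric]
    using nz lt by (simp add: field_simps)
  also have "\<dots> = (a + b) / (b * (4 * y))"
  proof -
    have "4 * y = (b + a) * (b - a)" using ab by (simp add: power2_eq_square algebra_simps)
    then show ?thesis using nz lt by (simp add: add.commute)
  qed
  also have "\<dots> \<le> (b + b) / (b * (4 * y))"
    using nz lt assms by (intro divide_right_mono) auto
  also have "\<dots> = 1 / (2 * y)" using nz assms by (simp add: field_simps)
  finally show "cmod (cayley ?u) / (cmod (1 + ?u\<^sup>2) * (1 - cmod (cayley ?u))) \<le> 1 / (2 * y)" .
qed

lemma gauss_power: "gauss m u = gauss 1 u ^ m"
  unfolding gauss_def exp_of_nat_mult[symmetric] by (simp add: algebra_simps)

lemma norm_gauss: "cmod (gauss m (Complex x y)) = exp (real m / sqrt 2 * (y\<^sup>2 - x\<^sup>2))"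
  unfolding gauss_def norm_exp_eq_Re by (simp add: power2_eq_square algebra_simps diff_divide_distrib)

text \<open>In terms of \<open>Y = x\<^sup>2 - 1/2\<close> the square of the left-hand side is
\<open>exp (- sqrt 2 * Y) * (2 - sqrt 2 + Y) / (2 + sqrt 2 + Y)\<close>. The quotient is \<open>rho\<^sup>2 * (1 + T)\<close> with
\<open>T = sqrt 2 * Y + O(Y\<^sup>2)\<close>; the linear terms cancel since \<open>Y = 0\<close> is the saddle point, and
\<open>1 + T \<le> exp T\<close> leaves a negative quadratic term.\<close>

lemma norm_saddle_line_1:
  "cmod (gauss 1 (Complex x saddle_im) * cayley (Complex x saddle_im))
     \<le> rho * exp (- (rho / 4) * (\<bar>x\<bar> - saddle_im)\<^sup>2)"
proof (rule power2_le_imp_le)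
  define Y where "Y = x\<^sup>2 - 1/2"
  define d where "d = \<bar>x\<bar> - saddle_im"
  define D where "D = 2 + (2 - sqrt 2) * Y"
  define s where "s = sqrt (2::real)"
  have s: "s * s = 2" "1 < s" "s < 3/2"
    using real_sqrt_less_mono[of 2 "9/4"] by (auto simp: s_def real_sqrt_divide)
  have Y: "Y \<ge> - 1/2" by (simp add: Y_def)
  have "(2 - s) * Y \<ge> (2 - s) * (- 1/2)"
    using Y s by (intro mult_left_mono) auto
  then have D: "D > 0" using s unfolding D_def s_def[symmetric] by argo
  have D4: "D \<le> 4 * (1 + Y)"
    using Y s mult_right_mono[of 1 s "Y + 1/2"] by (simp add: D_def s_def[symmetric] algebra_simps)
  have sd: "saddle_im * saddle_im = 1/2"
    using saddle_im(3) by (simp add: power2_eq_square)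
  have "Y = d * (\<bar>x\<bar> + saddle_im)"
    unfolding Y_def d_def power2_eq_square using sd by (simp add: algebra_simps)
  then have Y2: "4 * Y\<^sup>2 = d\<^sup>2 * (4 * (\<bar>x\<bar> + saddle_im)\<^sup>2)"
    by (simp add: power_mult_distrib)
  have "(\<bar>x\<bar> + saddle_im)\<^sup>2 = 1 + Y + 2 * (\<bar>x\<bar> * saddle_im)"
    using saddle_im(3) by (simp add: Y_def power2_sum)
  then have "4 * (\<bar>x\<bar> + saddle_im)\<^sup>2 \<ge> 4 * (1 + Y)"
    using saddle_im(1) by simp
  then have "d\<^sup>2 * (4 * (\<bar>x\<bar> + saddle_im)\<^sup>2) \<ge> d\<^sup>2 * D"
    using D4 by (intro mult_left_mono) auto
  then have key: "d\<^sup>2 * D \<le> 4 * Y\<^sup>2" using Y2 by simp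
  define T where "T = 2 * s * Y / ((2 - s) * (2 + s + Y))"
  have pos: "2 + s + Y > 0" "2 - s > 0" using s Y by auto
  have DT: "(2 - s) * (2 + s + Y) = D"
    using s by (simp add: D_def s_def[symmetric] algebra_simps)
  have ratio: "(2 - s + Y) / (2 + s + Y) = rho\<^sup>2 * (1 + T)"
  proof -
    have "rho\<^sup>2 * (2 + s) = 2 - s"
      using s by (simp add: rho_def s_def[symmetric] power2_eq_square algebra_simps)
    then have "rho\<^sup>2 = (2 - s) / (2 + s)"
      using s by (simp add: field_simps)
    moreover have "(2 - s + Y) / (2 + s + Y) = (2 - s) / (2 + s) * (1 + T)"
    proof -
      have "1 + T = ((2 - s) * (2 + s + Y) + 2 * s * Y) / ((2 - s) * (2 + s + Y))"
        unfolding T_def using pos by (simp add: add_divide_distrib)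
      also have "(2 - s) * (2 + s + Y) + 2 * s * Y = (2 + s) * (2 - s + Y)"
        by (simp add: algebra_simps)
      finally show ?thesis using pos s by simp
    qed
    ultimately show ?thesis by simp
  qed
  have "- s * Y + T = (- s * Y * D + 2 * s * Y) / D"
    unfolding T_def DT using D by (simp add: field_simps)
  also have "- s * Y * D + 2 * s * Y = - 2 * rho * Y\<^sup>2"
  proof -
    have "- s * Y * D + 2 * s * Y = - (2 * s - s * s) * Y\<^sup>2"
      unfolding D_def s_def[symmetric] by (simp add: power2_eq_square algebra_simps)
    then show ?thesis unfolding s(1) rho_def s_def[symmetric] by simp
  qed
  also have "- 2 * rho * Y\<^sup>2 / D \<le> - (rho / 2) * d\<^sup>2"
  proof -
    have "rho / 2 * (d\<^sup>2 * D) \<le> rho / 2 * (4 * Y\<^sup>2)"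
      using key rho_pos by (intro mult_left_mono) auto
    then show ?thesis using D by (simp add: field_simps)
  qed
  finally have expo: "- s * Y + T \<le> - (rho / 2) * d\<^sup>2" .
  have "(cmod (cayley (Complex x saddle_im)))\<^sup>2 = (2 - s + Y) / (2 + s + Y)"
    unfolding cayley_def norm_divide power_divide norm_cayley_num norm_cayley_den
    using s by (simp add: saddle_im_def s_def[symmetric] Y_def power2_eq_square algebra_simps)
  moreover have "(cmod (gauss 1 (Complex x saddle_im)))\<^sup>2 = exp (- s * Y)"
  proof -
    have "(cmod (gauss 1 (Complex x saddle_im)))\<^sup>2 = exp (2 * (1 / s * (1/2 - x\<^sup>2)))"
      unfolding exp_double norm_gauss saddle_im(3) s_def by simp
    also have "2 * (1 / s * (1/2 - x\<^sup>2)) = - s * Y"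
    proof -
      have "2 * (1 / s * (1/2 - x\<^sup>2)) = - (2 / s) * Y" by (simp add: Y_def algebra_simps)
      also have "2 / s = s" using s by (simp add: field_simps)
      finally show ?thesis .
    qed
    finally show ?thesis .
  qed
  ultimately have "(cmod (gauss 1 (Complex x saddle_im) * cayley (Complex x saddle_im)))\<^sup>2
      = exp (- s * Y) * (rho\<^sup>2 * (1 + T))"
    by (simp only: norm_mult power_mult_distrib ratio)
  also have "\<dots> \<le> exp (- s * Y) * (rho\<^sup>2 * exp T)"
    by (intro mult_left_mono) auto
  also have "\<dots> = rho\<^sup>2 * exp (- s * Y + T)" by (simp only: exp_add mult_ac)
  also have "\<dots> \<le> rho\<^sup>2 * exp (- (rho / 2) * d\<^sup>2)"
    using expo by (intro mult_left_mono) auto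
  also have "exp (- (rho / 2) * d\<^sup>2) = (exp (- (rho / 4) * d\<^sup>2))\<^sup>2"
    by (simp flip: exp_double)
  finally show "(cmod (gauss 1 (Complex x saddle_im) * cayley (Complex x saddle_im)))\<^sup>2
      \<le> (rho * exp (- (rho / 4) * (\<bar>x\<bar> - saddle_im)\<^sup>2))\<^sup>2"
    by (simp add: power_mult_distrib d_def)
qed (use rho_pos in auto)

lemma norm_saddle_line:
  "cmod (gauss m (Complex x saddle_im) * cayley (Complex x saddle_im) ^ m)
     \<le> rho ^ m * exp (- (rho / 4) * real m * (\<bar>x\<bar> - saddle_im)\<^sup>2)"
proof -
  let ?z = "gauss 1 (Complex x saddle_im) * cayley (Complex x saddle_im)"
  have "cmod (gauss m (Complex x saddle_im) * cayley (Complex x saddle_im) ^ m) = cmod ?z ^ m"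
    by (subst gauss_power) (simp add: norm_mult norm_power power_mult_distrib)
  also have "\<dots> \<le> (rho * exp (- (rho / 4) * (\<bar>x\<bar> - saddle_im)\<^sup>2)) ^ m"
    by (intro power_mono norm_saddle_line_1) auto
  also have "\<dots> = rho ^ m * exp (- (rho / 4) * real m * (\<bar>x\<bar> - saddle_im)\<^sup>2)"
    by (simp add: power_mult_distrib mult_ac flip: exp_of_nat_mult)
  finally show ?thesis .
qed

section \<open>Cauchy's formula on a strip\<close>

lemma has_bochner_integral_gaussian:
  fixes c mu :: real
  assumes "c > 0"
  shows "has_bochner_integral lborel (\<lambda>x. exp (- c * (x - mu)\<^sup>2)) (sqrt (pi / c))"
proof -
  \<comment> \<open>The standard deviation for which the normal density is proportional to the integrand.\<close>
  define \<sigma> where "\<sigma> = sqrt (1 / (2 * c))"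
  have \<sigma>: "\<sigma> > 0" "\<sigma>\<^sup>2 = 1 / (2 * c)" using assms by (auto simp: \<sigma>_def)
  have "has_bochner_integral lborel (\<lambda>x. sqrt (pi / c) * normal_density mu \<sigma> x) (sqrt (pi / c) * 1)"
    using normal_moment_even[OF \<sigma>(1), of mu 0] by (intro has_bochner_integral_mult_right) simp
  also have "(\<lambda>x. sqrt (pi / c) * normal_density mu \<sigma> x) = (\<lambda>x. exp (- c * (x - mu)\<^sup>2))"
    using assms by (auto simp: normal_density_def \<sigma>(2) fun_eq_iff real_sqrt_divide)
  finally show ?thesis by simp
qed

lemma has_bochner_integral_inverse_one_plus_square:
  "has_bochner_integral lborel (\<lambda>x::real. 1 / (1 + x\<^sup>2)) pi"
proof -
  have nz: "1 + x\<^sup>2 \<noteq> 0" "\<not> 1 + x\<^sup>2 < 0" for x :: real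
    using add_pos_nonneg[of 1 "x\<^sup>2"] by auto
  have "(\<integral>\<^sup>+x. ennreal (1 / (1 + x\<^sup>2)) * indicator {0..} x \<partial>lborel) = ennreal (pi / 2 - arctan 0)"
    by (rule nn_integral_FTC_atLeast)
       (auto intro!: derivative_eq_intros tendsto_arctan_at_top simp: divide_simps nz)
  also have "(\<integral>\<^sup>+x. ennreal (1 / (1 + x\<^sup>2)) * indicator {0..} x \<partial>lborel)
      = (\<integral>\<^sup>+x. ennreal (indicator {0..} x *\<^sub>R (1 / (1 + x\<^sup>2))) \<partial>lborel)"
    by (intro nn_integral_cong) (auto split: split_indicator)
  finally have "has_bochner_integral lborel (\<lambda>x::real. indicator {0..} x *\<^sub>R (1 / (1 + x\<^sup>2))) (pi / 2)"
    by (intro has_bochner_integral_nn_integral) auto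
  from has_bochner_integral_even_function[OF this] show ?thesis by simp
qed

lemma has_bochner_integral_Poisson_kernel:
  fixes y \<tau> :: real
  assumes "y > 0"
  shows "has_bochner_integral lborel (\<lambda>x. y / ((x - \<tau>)\<^sup>2 + y\<^sup>2)) pi"
proof -
  have "has_bochner_integral lborel (\<lambda>x. 1 / (1 + (- \<tau> / y + 1 / y * x)\<^sup>2)) (pi /\<^sub>R \<bar>1 / y\<bar>)"
    using has_bochner_integral_inverse_one_plus_square assms
    by (subst (asm) lborel_has_bochner_integral_real_affine_iff[where c = "1 / y" and t = "- \<tau> / y"]) auto
  then have "has_bochner_integral lborel (\<lambda>x. 1 / y * (1 / (1 + (- \<tau> / y + 1 / y * x)\<^sup>2))) (1 / y * (pi /\<^sub>R \<bar>1 / y\<bar>))"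
    by (rule has_bochner_integral_mult_right)
  also have "1 / y * (pi /\<^sub>R \<bar>1 / y\<bar>) = pi" using assms by simp
  also have "(\<lambda>x. 1 / y * (1 / (1 + (- \<tau> / y + 1 / y * x)\<^sup>2))) = (\<lambda>x. y / ((x - \<tau>)\<^sup>2 + y\<^sup>2))"
  proof
    fix x
    have "1 + (- \<tau> / y + 1 / y * x)\<^sup>2 = ((x - \<tau>)\<^sup>2 + y\<^sup>2) / y\<^sup>2"
      using assms by (simp add: field_simps power2_eq_square)
    then show "1 / y * (1 / (1 + (- \<tau> / y + 1 / y * x)\<^sup>2)) = y / ((x - \<tau>)\<^sup>2 + y\<^sup>2)"
      using assms by (simp add: power2_eq_square)
  qed
  finally show ?thesis .
qed

lemma gauss_uminus: "gauss m (- u) = gauss m u"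
  by (simp add: gauss_def)

lemma continuous_gauss: "continuous_on S (gauss m)"
  unfolding gauss_def by (intro continuous_intros)

lemma gauss_has_derivative:
  "(gauss m has_field_derivative (- of_real (real m / sqrt 2) * (2 * u) * gauss m u)) (at u)"
  unfolding gauss_def by (auto intro!: derivative_eq_intros)

lemma integrable_gauss_line:
  assumes "m > 0" and \<phi>: "continuous_on UNIV \<phi>" and B: "\<And>x. norm (\<phi> x) \<le> B"
  shows "integrable lborel (\<lambda>x. gauss m (Complex x y) * \<phi> x)"
proof (rule Bochner_Integration.integrable_bound)
  let ?a = "real m / sqrt 2"
  have "?a > 0" using assms by simp
  then show "integrable lborel (\<lambda>x. exp (?a * y\<^sup>2) * exp (- ?a * (x - 0)\<^sup>2) * B)"
    using has_bochner_integral_gaussian[of ?a 0]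
    by (intro integrable_mult_left integrable_mult_right) (auto simp: has_bochner_integral_iff)
  have "continuous_on UNIV (\<lambda>x. gauss m (Complex x y) * \<phi> x)"
    by (intro continuous_intros \<phi> continuous_on_compose2[OF continuous_gauss]) auto
  then show "(\<lambda>x. gauss m (Complex x y) * \<phi> x) \<in> borel_measurable lborel"
    by (simp add: borel_measurable_continuous_onI)
  have "0 \<le> B" using B[of 0] norm_ge_zero order_trans by blast
  then show "AE x in lborel. norm (gauss m (Complex x y) * \<phi> x)
      \<le> norm (exp (?a * y\<^sup>2) * exp (- ?a * (x - 0)\<^sup>2) * B)"
  proof (intro AE_I2)
    fix x
    have "norm (gauss m (Complex x y)) = exp (?a * y\<^sup>2) * exp (- ?a * (x - 0)\<^sup>2)"
      unfolding norm_gauss exp_add[symmetric] by (simp add: algebra_simps)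
    then show "norm (gauss m (Complex x y) * \<phi> x)
      \<le> norm (exp (?a * y\<^sup>2) * exp (- ?a * (x - 0)\<^sup>2) * B)"
      using \<open>0 \<le> B\<close> B[of x] by (simp add: norm_mult mult_left_mono)
  qed
qed

lemma continuous_on_line: "continuous_on UNIV (\<lambda>x. Complex x y)"
  unfolding Complex_eq by (intro continuous_intros)

lemma integrable_Cauchy_gauss:
  fixes y \<tau> :: real
  assumes "m > 0" "y \<noteq> 0"
  shows "integrable lborel (\<lambda>x. gauss m (Complex x y) / (Complex x y - of_real \<tau>))"
proof -
  have nz: "Complex x y - of_real \<tau> \<noteq> 0" for x using assms by (simp add: complex_eq_iff)
  have "integrable lborel (\<lambda>x. gauss m (Complex x y) * (1 / (Complex x y - of_real \<tau>)))"
  proof (rule integrable_gauss_line[OF assms(1), where B = "1 / \<bar>y\<bar>"])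
    show "continuous_on UNIV (\<lambda>x. 1 / (Complex x y - of_real \<tau>))"
      using nz by (intro continuous_intros continuous_on_line) auto
    show "norm (1 / (Complex x y - of_real \<tau>)) \<le> 1 / \<bar>y\<bar>" for x
      using abs_Im_le_cmod[of "Complex x y - of_real \<tau>"] assms nz[of x]
      by (simp add: norm_divide divide_simps)
  qed
  then show ?thesis by simp
qed

text \<open>The line of integration is moved across \<open>\<tau>\<close> for the difference quotient of \<open>gauss m\<close> at \<open>\<tau>\<close>,
whose singularity is removable. The contribution of the subtracted constant is a multiple of the
Poisson kernel, whose integral is \<open>pi\<close>.\<close>

lemma gauss_Cauchy_strip:
  fixes y \<tau> :: real
  assumes m: "m > 0" and y: "y > 0"
  shows "(\<integral>x. gauss m (Complex x (- y)) / (Complex x (- y) - of_real \<tau>) \<partial>lborel)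
       - (\<integral>x. gauss m (Complex x y) / (Complex x y - of_real \<tau>) \<partial>lborel)
       = 2 * pi * \<i> * gauss m (of_real \<tau>)"
proof -
  let ?F = "gauss m" and ?t = "complex_of_real \<tau>"
  let ?a = "real m / sqrt 2"
  define D where "D u = (if u = ?t then deriv ?F ?t else (?F u - ?F ?t) / (u - ?t))" for u
  have dF: "?F field_differentiable at u" for u
    using gauss_has_derivative field_differentiable_def by blast
  have D_diff: "D field_differentiable at u" if "u \<noteq> ?t" for u
  proof -
    have "(\<lambda>u. (?F u - ?F ?t) / (u - ?t)) field_differentiable at u"
      using that by (intro derivative_intros dF) auto
    then obtain d where "((\<lambda>u. (?F u - ?F ?t) / (u - ?t)) has_field_derivative d) (at u)"
      by (auto simp: field_differentiable_def)
    then have "(D has_field_derivative d) (at u)"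
      by (rule has_field_derivative_transform_within_open[where S = "- {?t}"]) (use that in \<open>auto simp: D_def\<close>)
    then show ?thesis by (auto simp: field_differentiable_def)
  qed
  have "isCont D u" for u
  proof (cases "u = ?t")
    case True
    have "((\<lambda>v. (?F v - ?F ?t) / (v - ?t)) \<longlongrightarrow> deriv ?F ?t) (at ?t)"
      using dF[of ?t]
      by (metis DERIV_deriv_iff_field_differentiable has_field_derivative_iff)
    then have "(D \<longlongrightarrow> deriv ?F ?t) (at ?t)"
      by (rule Lim_transform_eventually) (auto simp: D_def eventually_at_filter)
    then show ?thesis using True by (simp add: isCont_def D_def)
  qed (use D_diff field_differentiable_imp_continuous_at in blast)
  then have D_cont: "continuous_on S D" for S
    by (simp add: continuous_at_imp_continuous_on)
  define J where "J s = (\<lambda>x. ?F (Complex x s) / (Complex x s - ?t))" for s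
  have Jint: "integrable lborel (J s)" if "s \<noteq> 0" for s
    unfolding J_def by (rule integrable_Cauchy_gauss[OF m that])
  define K where "K = (\<lambda>x. complex_of_real (y / ((x - \<tau>)\<^sup>2 + y\<^sup>2)))"
  have "has_bochner_integral lborel K (of_real pi)"
    unfolding K_def using has_bochner_integral_Poisson_kernel[OF y] by (rule has_bochner_integral_of_real)
  then have P: "integrable lborel K" "integral\<^sup>L lborel K = of_real pi"
    by (auto simp: has_bochner_integral_iff)
  have nz: "Complex x s - ?t \<noteq> 0" if "s \<noteq> 0" for x s using that by (simp add: complex_eq_iff)
  have eq: "D (Complex x (- y)) - D (Complex x y) = J (- y) x - J y x - 2 * \<i> * ?F ?t * K x" for x
  proof -
    have "1 / (Complex x (- y) - ?t) - 1 / (Complex x y - ?t) =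
      (Complex x y - Complex x (- y)) / ((Complex x (- y) - ?t) * (Complex x y - ?t))"
      using nz[of y x] nz[of "- y" x] y by (simp add: field_simps)
    also have "(Complex x (- y) - ?t) * (Complex x y - ?t) = of_real ((x - \<tau>)\<^sup>2 + y\<^sup>2)"
      by (simp add: complex_eq_iff power2_eq_square algebra_simps)
    also have "Complex x y - Complex x (- y) = 2 * \<i> * of_real y"
      by (simp add: complex_eq_iff)
    finally have "1 / (Complex x (- y) - ?t) - 1 / (Complex x y - ?t) = 2 * \<i> * K x"
      by (simp add: K_def)
    then have "2 * \<i> * ?F ?t * K x = ?F ?t * (1 / (Complex x (- y) - ?t) - 1 / (Complex x y - ?t))"
      by simp
    then show ?thesis
      using nz[of y x] nz[of "- y" x] y by (simp add: D_def J_def diff_divide_distrib right_diff_distrib)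
  qed
  have int: "integrable lborel (\<lambda>x. D (Complex x (- y)) - D (Complex x y))"
    unfolding eq using P Jint[of y] Jint[of "- y"] y
    by (intro Bochner_Integration.integrable_diff integrable_mult_right)
       auto
  have "0 = (\<integral>x. D (Complex x (- y)) - D (Complex x y) \<partial>lborel)"
  proof (rule integral_horizontal_line_shift[symmetric, where a = "- y - 1" and b = "y + 1" and K = "{?t}"
        and R = "2 * \<bar>\<tau>\<bar> + 1" and C = "(exp (?a * y\<^sup>2) + 1) * 2"])
    fix x s assume x: "2 * \<bar>\<tau>\<bar> + 1 \<le> \<bar>x\<bar>" and s: "- y \<le> s" "s \<le> y"
    have "\<bar>x\<bar> / 2 \<le> \<bar>x - \<tau>\<bar>" using x by linarith
    also have "\<dots> \<le> cmod (Complex x s - ?t)"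
      using abs_Re_le_cmod[of "Complex x s - ?t"] by simp
    finally have den: "\<bar>x\<bar> / 2 \<le> cmod (Complex x s - ?t)" .
    have "s\<^sup>2 \<le> y\<^sup>2" using s by (simp add: abs_le_square_iff[symmetric])
    then have "s\<^sup>2 - x\<^sup>2 \<le> y\<^sup>2" using zero_le_power2[of x] by linarith
    then have "?a * (s\<^sup>2 - x\<^sup>2) \<le> ?a * y\<^sup>2" by (intro mult_left_mono) auto
    then have "cmod (?F (Complex x s)) \<le> exp (?a * y\<^sup>2)"
      unfolding norm_gauss by simp
    moreover have "cmod (?F ?t) \<le> 1"
      using norm_gauss[of m \<tau> 0] by (simp add: complex_of_real_def)
    ultimately have num: "cmod (?F (Complex x s) - ?F ?t) \<le> exp (?a * y\<^sup>2) + 1"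
      using norm_triangle_ineq4[of "?F (Complex x s)" "?F ?t"] by linarith
    have "Complex x s \<noteq> ?t" using x by (auto simp: complex_eq_iff)
    then have "cmod (D (Complex x s)) = cmod (?F (Complex x s) - ?F ?t) / cmod (Complex x s - ?t)"
      by (simp add: D_def norm_divide)
    also have "\<dots> \<le> (exp (?a * y\<^sup>2) + 1) / (\<bar>x\<bar> / 2)"
      using x by (intro frac_le num den) (auto intro: add_nonneg_nonneg)
    finally show "cmod (D (Complex x s)) \<le> (exp (?a * y\<^sup>2) + 1) * 2 / \<bar>x\<bar>" by simp
  qed (use y int in \<open>auto intro: D_cont D_diff\<close>)
  also have "\<dots> = (integral\<^sup>L lborel (J (- y)) - integral\<^sup>L lborel (J y)) - 2 * \<i> * ?F ?t * of_real pi"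
    unfolding eq using P Jint[of y] Jint[of "- y"] y by simp
  finally show ?thesis by (simp add: J_def algebra_simps)
qed

text \<open>Since \<open>gauss m\<close> is even, the lower line of the strip can be reflected to the upper one.\<close>

lemma gauss_Cauchy_line:
  fixes y \<tau> :: real
  assumes m: "m > 0" and y: "y > 0"
  shows "gauss m (of_real \<tau>) = \<i> / (2 * pi) *
     (\<integral>x. gauss m (Complex x y) * (1 / (Complex x y - of_real \<tau>) + 1 / (Complex x y + of_real \<tau>)) \<partial>lborel)"
proof -
  let ?t = "complex_of_real \<tau>"
  have "(\<integral>x. gauss m (Complex x (- y)) / (Complex x (- y) - ?t) \<partial>lborel)
      = (\<integral>x. gauss m (Complex (- x) (- y)) / (Complex (- x) (- y) - ?t) \<partial>lborel)"
    using lborel_integral_real_affine[of "- 1" "\<lambda>x. gauss m (Complex x (- y)) / (Complex x (- y) - ?t)" 0]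
    by simp
  also have "\<dots> = (\<integral>x. - (gauss m (Complex x y) / (Complex x y - of_real (- \<tau>))) \<partial>lborel)"
  proof (intro Bochner_Integration.integral_cong refl)
    fix x
    have 1: "Complex (- x) (- y) = - Complex x y" by (simp add: complex_eq_iff)
    have "- Complex x y - ?t = - (Complex x y - of_real (- \<tau>))" by simp
    then show "gauss m (Complex (- x) (- y)) / (Complex (- x) (- y) - ?t)
        = - (gauss m (Complex x y) / (Complex x y - of_real (- \<tau>)))"
      unfolding 1 gauss_uminus by (simp only: divide_minus_right)
  qed
  finally have "2 * pi * \<i> * gauss m ?t =
      - (\<integral>x. gauss m (Complex x y) / (Complex x y - of_real (- \<tau>)) \<partial>lborel)
      - (\<integral>x. gauss m (Complex x y) / (Complex x y - ?t) \<partial>lborel)"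
    using gauss_Cauchy_strip[OF m y, of \<tau>] by simp
  also have "\<dots> = - ((\<integral>x. gauss m (Complex x y) / (Complex x y - ?t) \<partial>lborel)
      + (\<integral>x. gauss m (Complex x y) / (Complex x y - of_real (- \<tau>)) \<partial>lborel))"
    by simp
  also have "\<dots> = - (\<integral>x. gauss m (Complex x y) / (Complex x y - ?t)
      + gauss m (Complex x y) / (Complex x y - of_real (- \<tau>)) \<partial>lborel)"
    using y by (subst Bochner_Integration.integral_add) (auto intro!: integrable_Cauchy_gauss m simp del: of_real_minus)
  also have "(\<lambda>x. gauss m (Complex x y) / (Complex x y - ?t)
      + gauss m (Complex x y) / (Complex x y - of_real (- \<tau>)))
     = (\<lambda>x. gauss m (Complex x y) * (1 / (Complex x y - ?t) + 1 / (Complex x y + ?t)))"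
    by (auto simp: fun_eq_iff distrib_left)
  finally have eq: "2 * pi * \<i> * gauss m ?t = - (\<integral>x. gauss m (Complex x y) * (1 / (Complex x y - ?t) + 1 / (Complex x y + ?t)) \<partial>lborel)" .
  have "gauss m ?t = - \<i> / (2 * pi) * (2 * pi * \<i> * gauss m ?t)"
    by simp
  also have "\<dots> = \<i> / (2 * pi) * (\<integral>x. gauss m (Complex x y) * (1 / (Complex x y - ?t) + 1 / (Complex x y + ?t)) \<partial>lborel)"
    unfolding eq by simp
  finally show ?thesis .
qed

section \<open>Expansion of the Cauchy kernel\<close>

text \<open>Both points are moved to the disc. With \<open>w = cayley u\<close> and \<open>v = cayley \<tau>\<close> the kernel becomes a
multiple of \<open>1 / (w - v)\<close> up to a term that does not depend on \<open>\<tau>\<close>, and \<open>1 / (w - v)\<close> is a geometric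
series in \<open>q = w / v\<close>.\<close>

lemma Cauchy_kernel_expansion:
  fixes \<tau> :: real
  assumes u: "0 < Im u" "Im u < 1"
  defines "q \<equiv> cayley u / cayley (of_real \<tau>)"
  shows "1 / (u - of_real \<tau>) = - (2 * \<i> / (1 + u\<^sup>2)) *
     ((1 + \<i> * u) / 2 + (\<Sum>k=1..m. q ^ k) + q ^ Suc m / (1 - q))"
    and "norm q = norm (cayley u)"
proof -
  let ?t = "complex_of_real \<tau>"
  define a b c d where "a = 1 + \<i> * u" and "b = 1 - \<i> * u" and "c = 1 + \<i> * ?t" and "d = 1 - \<i> * ?t"
  have nz: "a \<noteq> 0" "b \<noteq> 0" "c \<noteq> 0" "d \<noteq> 0"
    using cayley_factors_nz[of u] cayley_factors_nz[of ?t] u by (auto simp: a_def b_def c_def d_def)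
  have ut: "u - ?t \<noteq> 0" using u by (auto simp: complex_eq_iff)
  have q: "q = (a * d) / (b * c)"
    using nz by (simp add: q_def cayley_def a_def b_def c_def d_def)
  have diff: "b * c - a * d = - 2 * \<i> * (u - ?t)"
    by (simp add: a_def b_def c_def d_def algebra_simps)
  then have q1: "q \<noteq> 1" using nz ut unfolding q by auto
  have "1 - q = - 2 * \<i> * (u - ?t) / (b * c)"
    unfolding q diff[symmetric] using nz by (simp add: field_simps)
  then have qq: "q / (1 - q) = a * d / (- 2 * \<i> * (u - ?t))"
    unfolding q using nz ut by simp
  have "a / 2 + q / (1 - q) = (a / 2) * ((- \<i> * (u - ?t) + d) / (- \<i> * (u - ?t)))"
    unfolding qq using ut by (simp add: field_simps)
  also have "- \<i> * (u - ?t) + d = b"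
    by (simp add: b_def d_def algebra_simps)
  finally have "a / 2 + q / (1 - q) = (1 + u\<^sup>2) / (- 2 * \<i> * (u - ?t))"
    unfolding one_plus_square a_def[symmetric] b_def[symmetric] using ut by simp
  then have "1 / (u - ?t) = - (2 * \<i> / (1 + u\<^sup>2)) * (a / 2 + q / (1 - q))"
    using nz ut unfolding one_plus_square a_def[symmetric] b_def[symmetric] by simp
  moreover have "(\<Sum>k=1..m. q ^ k) + q ^ Suc m / (1 - q) = q / (1 - q)"
  proof (induction m)
    case (Suc m)
    have "q ^ Suc m + q ^ Suc (Suc m) / (1 - q) = q ^ Suc m / (1 - q)"
      using q1 by (simp add: field_simps)
    then show ?case using Suc by (simp add: add.assoc)
  qed auto
  ultimately show "1 / (u - of_real \<tau>) = - (2 * \<i> / (1 + u\<^sup>2)) *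
     ((1 + \<i> * u) / 2 + (\<Sum>k=1..m. q ^ k) + q ^ Suc m / (1 - q))"
    by (simp add: a_def add.assoc)
  have "norm c = norm d" by (simp add: c_def d_def cmod_def)
  then show "norm q = norm (cayley u)"
    using nz unfolding q cayley_def a_def[symmetric] b_def[symmetric]
    by (simp add: norm_divide norm_mult)
qed

lemma cayley_real:
  fixes \<tau> :: real
  shows "norm (cayley (of_real \<tau>)) = 1" "cayley (of_real (- \<tau>)) = cnj (cayley (of_real \<tau>))"
    "cayley (of_real \<tau>) * cnj (cayley (of_real \<tau>)) = 1"
proof -
  have 1: "norm (1 + \<i> * of_real \<tau>) = norm (1 - \<i> * of_real \<tau>)" by (simp add: cmod_def)
  have 2: "1 - \<i> * of_real \<tau> \<noteq> 0" using cayley_factors_nz(2)[of "of_real \<tau>"] by simp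
  then show *: "norm (cayley (of_real \<tau>)) = 1"
    unfolding cayley_def norm_divide 1 by simp
  then show "cayley (of_real \<tau>) * cnj (cayley (of_real \<tau>)) = 1"
    by (simp add: complex_mult_cnj cmod_power2[symmetric])
  show "cayley (of_real (- \<tau>)) = cnj (cayley (of_real \<tau>))" by (simp add: cayley_def)
qed

text \<open>These are the Chebyshev polynomials in the variable \<open>2 * s - 1\<close> with \<open>s = 1 / (1 + \<tau>\<^sup>2)\<close>, obtained
here from their three-term recurrence.\<close>

lemma Re_cayley_power_poly:
  "\<exists>p. degree p \<le> k \<and> (\<forall>\<tau>::real. poly p (1 / (1 + \<tau>\<^sup>2)) = Re (cayley (of_real \<tau>) ^ k))"
proof (induction k rule: less_induct)
  case (less k)
  consider "k = 0" | "k = 1" | n where "k = Suc (Suc n)"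
    by (metis One_nat_def not0_implies_Suc)
  then show ?case
  proof cases
    case 1
    then show ?thesis by (intro exI[of _ 1]) auto
  next
    case 2
    have "Re (cayley (of_real \<tau>)) = 2 / (1 + \<tau>\<^sup>2) - 1" for \<tau> :: real
    proof -
      have "1 + \<tau>\<^sup>2 \<noteq> 0" using add_pos_nonneg[of 1 "\<tau>\<^sup>2"] by simp
      then show ?thesis
        by (simp add: cayley_def Re_divide field_simps power2_eq_square)
    qed
    then show ?thesis using 2 by (intro exI[of _ "[:-1, 2:]"]) auto
  next
    case 3
    obtain p where p: "degree p \<le> n" "\<And>\<tau>::real. poly p (1 / (1 + \<tau>\<^sup>2)) = Re (cayley (of_real \<tau>) ^ n)"
      using less.IH[of n] 3 by auto
    obtain p' where p': "degree p' \<le> Suc n" "\<And>\<tau>::real. poly p' (1 / (1 + \<tau>\<^sup>2)) = Re (cayley (of_real \<tau>) ^ Suc n)"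
      using less.IH[of "Suc n"] 3 by auto
    have rec: "Re (v ^ Suc (Suc n)) = 2 * Re v * Re (v ^ Suc n) - Re (v ^ n)" if "v * cnj v = 1" for v
    proof -
      have "v ^ Suc (Suc n) + v ^ n = v ^ Suc n * (v + cnj v)"
        using that by (simp add: algebra_simps)
      also have "v + cnj v = of_real (2 * Re v)" by (simp add: complex_add_cnj)
      finally have "Re (v ^ Suc (Suc n) + v ^ n) = Re (v ^ Suc n * of_real (2 * Re v))" by simp
      then show ?thesis by (simp add: mult.commute del: power_Suc)
    qed
    obtain c where c: "degree c \<le> 1" "\<And>\<tau>::real. poly c (1 / (1 + \<tau>\<^sup>2)) = Re (cayley (of_real \<tau>))"
      using less.IH[of 1] 3 by auto
    have "degree (2 * c * p' - p) \<le> Suc (Suc n)"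
    proof (rule degree_diff_le)
      have "degree (smult 2 c * p') \<le> degree c + degree p'"
        by (rule order_trans[OF degree_mult_le]) simp
      then show "degree (2 * c * p') \<le> Suc (Suc n)"
        using c p' by (simp add: numeral_poly)
    qed (use p in auto)
    moreover have "poly (2 * c * p' - p) (1 / (1 + \<tau>\<^sup>2)) = Re (cayley (of_real \<tau>) ^ k)" for \<tau> :: real
      unfolding 3 rec[OF cayley_real(3)] by (simp add: c p p' del: power_Suc)
    ultimately show ?thesis unfolding 3 by blast
  qed
qed

lemma Gaussian_two_humps:
  assumes "c > 0"
  shows "integrable lborel (\<lambda>x. exp (- c * (\<bar>x\<bar> - h)\<^sup>2))"
    and "(\<integral>x. exp (- c * (\<bar>x\<bar> - h)\<^sup>2) \<partial>lborel) \<le> 2 * sqrt (pi / c)"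
proof -
  let ?g = "\<lambda>x. exp (- c * (x - h)\<^sup>2) + exp (- c * (x - - h)\<^sup>2)"
  have G: "has_bochner_integral lborel ?g (sqrt (pi / c) + sqrt (pi / c))"
    by (intro has_bochner_integral_add has_bochner_integral_gaussian assms)
  have le: "exp (- c * (\<bar>x\<bar> - h)\<^sup>2) \<le> ?g x" for x
  proof (cases "x \<ge> 0")
    case False
    then have "(\<bar>x\<bar> - h)\<^sup>2 = (x - - h)\<^sup>2" by (simp add: power2_eq_square algebra_simps)
    then show ?thesis by simp
  qed simp
  show int: "integrable lborel (\<lambda>x. exp (- c * (\<bar>x\<bar> - h)\<^sup>2))"
    by (rule Bochner_Integration.integrable_bound[of _ ?g])
       (use G le in \<open>auto simp: has_bochner_integral_iff\<close>)
  have "(\<integral>x. exp (- c * (\<bar>x\<bar> - h)\<^sup>2) \<partial>lborel) \<le> integral\<^sup>L lborel ?g"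
    using G by (intro integral_mono int le) (auto simp: has_bochner_integral_iff)
  then show "(\<integral>x. exp (- c * (\<bar>x\<bar> - h)\<^sup>2) \<partial>lborel) \<le> 2 * sqrt (pi / c)"
    using G by (simp add: has_bochner_integral_iff)
qed

section \<open>The upper bound for polynomial approximation\<close>

lemma continuous_cayley_line:
  assumes "\<bar>y\<bar> < 1"
  shows "continuous_on UNIV (\<lambda>x. cayley (Complex x y))" "continuous_on UNIV (\<lambda>x. 1 + (Complex x y)\<^sup>2)"
  unfolding cayley_def using assms cayley_factors_nz[of "Complex _ y"]
  by (intro continuous_intros continuous_on_line; simp)+

definition upper_const :: real where
  "upper_const = 2 / (pi * saddle_im) * sqrt (4 * pi / rho)"

text \<open>The approximant is Cauchy's formula with the kernel truncated after the power \<open>m\<close>. Adding the kernels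
of \<open>\<tau>\<close> and \<open>- \<tau>\<close>, whose Cayley transforms are conjugate, turns the powers of \<open>q\<close> into real parts of
powers of \<open>cayley \<tau>\<close>.\<close>

lemma gauss_approx_complex:
  assumes m: "m > 0"
  shows "\<exists>A d. \<forall>\<tau>::real. norm (gauss m (of_real \<tau>) - (A + (\<Sum>k=1..m. d k * of_real (Re (cayley (of_real \<tau>) ^ k)))))
             \<le> upper_const * rho ^ m / sqrt m"
proof -
  define u where "u x = Complex x saddle_im" for x
  define w where "w x = cayley (u x)" for x
  define P where "P x = 1 + (u x)\<^sup>2" for x
  have im: "0 < Im (u x)" "Im (u x) < 1" for x by (simp_all add: u_def saddle_im)
  have abs1: "\<bar>saddle_im\<bar> < 1" using saddle_im by simp
  have P0: "P x \<noteq> 0" for x using cayley_factors_nz(3)[of "u x"] im[of x] by (simp add: P_def)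
  have w1: "norm (w x) < 1" for x
    using norm_cayley_tail_le(1) saddle_im by (simp add: w_def u_def)
  have wP: "norm (w x / P x) \<le> 1" for x
  proof -
    have "norm (w x / P x) \<le> 1 / (1 + x\<^sup>2)"
      using norm_cayley_over_le[of saddle_im x] saddle_im by (simp add: w_def P_def u_def)
    also have "\<dots> \<le> 1" by (simp add: divide_le_eq_1 add_pos_nonneg)
    finally show ?thesis .
  qed
  have tail: "norm (w x) / (norm (P x) * (1 - norm (w x))) \<le> 1 / (2 * saddle_im)" for x
    using norm_cayley_tail_le(2) saddle_im by (simp add: w_def u_def P_def)
  have cont: "continuous_on UNIV w" "continuous_on UNIV P" "continuous_on UNIV u"
    unfolding w_def P_def u_def using continuous_cayley_line[OF abs1] continuous_on_line by auto
  define I where "I \<phi> = (\<integral>x. gauss m (u x) * \<phi> x \<partial>lborel)" for \<phi> :: "real \<Rightarrow> complex"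
  have int: "integrable lborel (\<lambda>x. gauss m (u x) * \<phi> x)"
    if "continuous_on UNIV \<phi>" "\<And>x. norm (\<phi> x) \<le> B" for \<phi> :: "real \<Rightarrow> complex" and B
    unfolding u_def by (rule integrable_gauss_line[OF m that])
  have intA: "integrable lborel (\<lambda>x. gauss m (u x) * ((1 + \<i> * u x) / P x))"
  proof (rule int)
    show "continuous_on UNIV (\<lambda>x. (1 + \<i> * u x) / P x)" using P0 by (intro continuous_intros cont) auto
    fix x
    have "(1 + \<i> * u x) / P x = 1 / (1 - \<i> * u x)"
      unfolding P_def one_plus_square using cayley_factors_nz[of "u x"] im[of x] by simp
    moreover have "1 \<le> norm (1 - \<i> * u x)"
      using abs_Re_le_cmod[of "1 - \<i> * u x"] im[of x] by simp
    ultimately show "norm ((1 + \<i> * u x) / P x) \<le> 1"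
      by (simp add: norm_divide divide_le_eq_1)
  qed
  have intk: "integrable lborel (\<lambda>x. gauss m (u x) * (w x ^ k / P x))" if "k \<ge> 1" for k
  proof (rule int)
    show "continuous_on UNIV (\<lambda>x. w x ^ k / P x)" using P0 by (intro continuous_intros cont) auto
    fix x
    have "w x ^ k / P x = w x ^ (k - 1) * (w x / P x)" using that by (cases k) auto
    then have "norm (w x ^ k / P x) = norm (w x) ^ (k - 1) * norm (w x / P x)"
      by (simp only: norm_mult norm_power)
    also have "\<dots> \<le> 1 * 1"
      using w1[of x] by (intro mult_mono wP power_le_one) auto
    finally show "norm (w x ^ k / P x) \<le> 1" by simp
  qed
  have hI: "has_bochner_integral lborel (\<lambda>x. gauss m (u x) * \<phi> x) (I \<phi>)"
    if "integrable lborel (\<lambda>x. gauss m (u x) * \<phi> x)" for \<phi>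
    unfolding I_def using that by (rule has_bochner_integral_integrable)
  \<comment> \<open>The coefficients of the approximant: the part of the kernel that does not depend on \<open>\<tau>\<close>, and the
    Fourier coefficients.\<close>
  define A where "A = I (\<lambda>x. (1 + \<i> * u x) / P x) / pi"
  define d where "d k = 2 * I (\<lambda>x. w x ^ k / P x) / pi" for k
  define q where "q \<tau> x = w x / cayley (of_real \<tau>)" for \<tau> :: real and x
  \<comment> \<open>The remainder of the geometric series in \<open>Cauchy_kernel_expansion\<close>.\<close>
  define r where "r \<tau> x = q \<tau> x ^ Suc m / ((1 - q \<tau> x) * P x)" for \<tau> :: real and x
  have nq: "norm (q \<tau> x) = norm (w x)" for \<tau> x
    by (simp add: q_def norm_divide cayley_real(1))
  have q1: "1 - q \<tau> x \<noteq> 0" for \<tau> x using nq[of \<tau> x] w1[of x] by auto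
  have r_bound: "norm (r \<tau> x) \<le> norm (w x) ^ m / (2 * saddle_im)" for \<tau> x
  proof -
    have "1 - norm (w x) \<le> norm (1 - q \<tau> x)"
      using norm_triangle_ineq2[of 1 "q \<tau> x"] nq[of \<tau> x] by simp
    then have "norm (r \<tau> x) \<le> norm (w x) ^ Suc m / ((1 - norm (w x)) * norm (P x))"
      unfolding r_def norm_divide norm_power norm_mult nq
      using P0 w1[of x] by (intro divide_left_mono mult_right_mono mult_pos_pos) auto
    also have "\<dots> = norm (w x) ^ m * (norm (w x) / (norm (P x) * (1 - norm (w x))))"
      by (simp add: mult.commute)
    also have "\<dots> \<le> norm (w x) ^ m * (1 / (2 * saddle_im))"
      by (intro mult_left_mono tail) auto
    finally show ?thesis by simp
  qed
  have int_r: "integrable lborel (\<lambda>x. gauss m (u x) * r \<tau> x)" for \<tau>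
  proof (rule int)
    have "cayley (of_real \<tau>) \<noteq> 0" using cayley_real(1)[of \<tau>] by auto
    then show "continuous_on UNIV (r \<tau>)"
      unfolding r_def q_def using P0 q1[of \<tau>, unfolded q_def] by (intro continuous_intros cont) auto
    show "norm (r \<tau> x) \<le> 1 / (2 * saddle_im)" for x
    proof -
      have "norm (w x) ^ m / (2 * saddle_im) \<le> 1 / (2 * saddle_im)"
        using w1[of x] saddle_im power_le_one[of "norm (w x)" m] by (intro divide_right_mono) auto
      then show ?thesis using r_bound[of \<tau> x] by linarith
    qed
  qed
  have Ir: "norm (I (r \<tau>)) \<le> rho ^ m * (2 * sqrt (4 * pi / rho) / sqrt m) / (2 * saddle_im)" for \<tau>
  proof -
    let ?c = "rho / 4 * real m"
    have c: "?c > 0" using m rho_pos by simp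
    have "norm (I (r \<tau>)) \<le> (\<integral>x. rho ^ m / (2 * saddle_im) * exp (- ?c * (\<bar>x\<bar> - saddle_im)\<^sup>2) \<partial>lborel)"
      unfolding I_def
    proof (rule Bochner_Integration.integral_norm_bound_integral)
      fix x
      have "norm (gauss m (u x) * r \<tau> x) \<le> norm (gauss m (u x)) * (norm (w x) ^ m / (2 * saddle_im))"
        unfolding norm_mult by (intro mult_left_mono r_bound) auto
      also have "\<dots> = norm (gauss m (u x) * w x ^ m) / (2 * saddle_im)"
        by (simp add: norm_mult norm_power)
      also have "\<dots> \<le> (rho ^ m * exp (- ?c * (\<bar>x\<bar> - saddle_im)\<^sup>2)) / (2 * saddle_im)"
        using norm_saddle_line[of m x] saddle_im by (intro divide_right_mono) (auto simp: u_def w_def)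
      finally show "norm (gauss m (u x) * r \<tau> x) \<le> rho ^ m / (2 * saddle_im) * exp (- ?c * (\<bar>x\<bar> - saddle_im)\<^sup>2)"
        by simp
    qed (use int_r Gaussian_two_humps(1)[OF c] in \<open>auto simp del: minus_mult_left mult_minus_left\<close>)
    also have "\<dots> = rho ^ m / (2 * saddle_im) * (\<integral>x. exp (- ?c * (\<bar>x\<bar> - saddle_im)\<^sup>2) \<partial>lborel)"
      by (rule Bochner_Integration.integral_mult_right_zero)
    also have "\<dots> \<le> rho ^ m / (2 * saddle_im) * (2 * sqrt (pi / ?c))"
      using rho_pos saddle_im by (intro mult_left_mono Gaussian_two_humps(2) c) auto
    also have "sqrt (pi / ?c) = sqrt (4 * pi / rho) / sqrt m"
      by (simp add: real_sqrt_divide real_sqrt_mult)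
    finally show ?thesis by (simp add: mult.commute)
  qed
  have main: "norm (gauss m (of_real \<tau>) - (A + (\<Sum>k=1..m. d k * of_real (Re (cayley (of_real \<tau>) ^ k)))))
      \<le> upper_const * rho ^ m / sqrt m" for \<tau> :: real
  proof -
    define v where "v = cayley (of_real \<tau>)"
    have vv: "v * cnj v = 1" "cayley (of_real (- \<tau>)) = cnj v" unfolding v_def by (rule cayley_real)+
    then have "v \<noteq> 0" by auto
    then have iv: "1 / v = cnj v" "1 / cnj v = v"
      using vv(1) by (simp_all add: divide_eq_eq mult.commute)
    define R where "R k = complex_of_real (Re (v ^ k))" for k
    have pair: "q \<tau> x ^ k + q (- \<tau>) x ^ k = 2 * (w x ^ k * R k)" for x k
    proof -
      have "q \<tau> x = w x * cnj v" "q (- \<tau>) x = w x * v"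
        using iv vv(2) by (simp_all add: q_def v_def[symmetric] divide_inverse flip: inverse_eq_divide)
      then have "q \<tau> x ^ k + q (- \<tau>) x ^ k = w x ^ k * (v ^ k + cnj (v ^ k))"
        by (simp add: power_mult_distrib algebra_simps)
      then show ?thesis unfolding complex_add_cnj by (simp add: R_def)
    qed
    have kern: "1 / (u x - of_real s) = - (2 * \<i> / P x) *
        ((1 + \<i> * u x) / 2 + (\<Sum>k=1..m. q s x ^ k) + q s x ^ Suc m / (1 - q s x))" for s x
      unfolding q_def w_def P_def by (rule Cauchy_kernel_expansion(1)[OF im])
    have sum: "1 / (u x - of_real \<tau>) + 1 / (u x + of_real \<tau>) =
       - 2 * \<i> * ((1 + \<i> * u x) / P x + (\<Sum>k=1..m. (w x ^ k / P x) * (2 * R k)) + (r \<tau> x + r (- \<tau>) x))" for x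
    proof -
      have "1 / (u x - of_real \<tau>) + 1 / (u x + of_real \<tau>) = 1 / (u x - of_real \<tau>) + 1 / (u x - of_real (- \<tau>))"
        by simp
      also have "\<dots> = - (2 * \<i> / P x) * ((1 + \<i> * u x) + ((\<Sum>k=1..m. q \<tau> x ^ k) + (\<Sum>k=1..m. q (- \<tau>) x ^ k))
          + (q \<tau> x ^ Suc m / (1 - q \<tau> x) + q (- \<tau>) x ^ Suc m / (1 - q (- \<tau>) x)))"
      proof -
        have "a / 2 + b + c + (a / 2 + b' + c') = a + (b + b') + (c + c')" for a b c b' c' :: complex
          by simp
        then show ?thesis unfolding kern distrib_left[symmetric] by (simp only:)
      qed
      also have "(\<Sum>k=1..m. q \<tau> x ^ k) + (\<Sum>k=1..m. q (- \<tau>) x ^ k) = (\<Sum>k=1..m. 2 * (w x ^ k * R k))"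
        by (simp only: sum.distrib[symmetric] pair)
      also have "- (2 * \<i> / P x) * ((1 + \<i> * u x) + (\<Sum>k=1..m. 2 * (w x ^ k * R k))
          + (q \<tau> x ^ Suc m / (1 - q \<tau> x) + q (- \<tau>) x ^ Suc m / (1 - q (- \<tau>) x)))
         = - 2 * \<i> * ((1 + \<i> * u x) / P x + (\<Sum>k=1..m. 2 * (w x ^ k * R k)) / P x + (r \<tau> x + r (- \<tau>) x))"
        using P0[of x] by (simp add: r_def add_divide_distrib distrib_left mult.commute[of "P x"] del: power_Suc)
      also have "(\<Sum>k=1..m. 2 * (w x ^ k * R k)) / P x = (\<Sum>k=1..m. (w x ^ k / P x) * (2 * R k))"
        by (simp add: sum_divide_distrib mult_ac)
      finally show ?thesis .
    qed
    have "gauss m (of_real \<tau>) = \<i> / (2 * pi) *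
        (\<integral>x. gauss m (u x) * (1 / (u x - of_real \<tau>) + 1 / (u x + of_real \<tau>)) \<partial>lborel)"
      unfolding u_def by (rule gauss_Cauchy_line[OF m]) (rule saddle_im)
    also have "(\<lambda>x. gauss m (u x) * (1 / (u x - of_real \<tau>) + 1 / (u x + of_real \<tau>))) =
       (\<lambda>x. - 2 * \<i> * (gauss m (u x) * ((1 + \<i> * u x) / P x)
          + (\<Sum>k=1..m. gauss m (u x) * (w x ^ k / P x) * (2 * R k))
          + (gauss m (u x) * r \<tau> x + gauss m (u x) * r (- \<tau>) x)))"
    proof -
      have "g * (c * (X + S + (r1 + r2))) = c * (g * X + g * S + (g * r1 + g * r2))"
        for g c X S r1 r2 :: complex
        by (simp add: algebra_simps)
      note distr = this
      show ?thesis unfolding sum distr by (simp only: sum_distrib_left mult.assoc)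
    qed
    also have "integral\<^sup>L lborel \<dots> = - 2 * \<i> * (I (\<lambda>x. (1 + \<i> * u x) / P x)
          + (\<Sum>k=1..m. I (\<lambda>x. w x ^ k / P x) * (2 * R k)) + (I (r \<tau>) + I (r (- \<tau>))))"
      by (intro has_bochner_integral_integral_eq has_bochner_integral_mult_right has_bochner_integral_add
            has_bochner_integral_sum has_bochner_integral_mult_left hI intA intk int_r) auto
    also have "\<i> / (2 * pi) * \<dots> = (I (\<lambda>x. (1 + \<i> * u x) / P x)
          + (\<Sum>k=1..m. I (\<lambda>x. w x ^ k / P x) * (2 * R k)) + (I (r \<tau>) + I (r (- \<tau>)))) / pi"
      by (simp add: field_simps)
    also have "\<dots> = A + (\<Sum>k=1..m. d k * R k) + (I (r \<tau>) + I (r (- \<tau>))) / pi"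
      by (simp add: A_def d_def add_divide_distrib sum_divide_distrib mult_ac)
    finally have "gauss m (of_real \<tau>) - (A + (\<Sum>k=1..m. d k * R k)) = (I (r \<tau>) + I (r (- \<tau>))) / pi"
      by simp
    then have "norm (gauss m (of_real \<tau>) - (A + (\<Sum>k=1..m. d k * R k))) \<le> (norm (I (r \<tau>)) + norm (I (r (- \<tau>)))) / pi"
      by (simp add: norm_divide divide_right_mono norm_triangle_ineq)
    also have "\<dots> \<le> (2 * (rho ^ m * (2 * sqrt (4 * pi / rho) / sqrt m) / (2 * saddle_im))) / pi"
    proof -
      have "(x + y) / pi \<le> (2 * C) / pi" if "x \<le> C" "y \<le> C" for x y C :: real
        using that by (intro divide_right_mono) auto
      then show ?thesis using Ir[of \<tau>] Ir[of "- \<tau>"] by blast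
    qed
    also have "\<dots> = upper_const * rho ^ m / sqrt m"
      by (simp add: upper_const_def mult_ac)
    finally show ?thesis by (simp add: R_def v_def)
  qed
  then show ?thesis by blast
qed

lemma gauss_real: "gauss m (of_real \<tau>) = of_real (exp (- (real m / sqrt 2) * \<tau>\<^sup>2))"
  by (simp add: gauss_def exp_of_real[symmetric])

lemma gauss_approx_poly:
  assumes m: "m > 0"
  shows "\<exists>Q. degree Q \<le> m \<and> (\<forall>\<tau>. \<bar>exp (- (real m / sqrt 2) * \<tau>\<^sup>2) - poly Q (1 / (1 + \<tau>\<^sup>2))\<bar>
             \<le> upper_const * rho ^ m / sqrt m)"
proof -
  obtain A d where Ad: "\<And>\<tau>::real. norm (gauss m (of_real \<tau>) - (A + (\<Sum>k=1..m. d k * of_real (Re (cayley (of_real \<tau>) ^ k)))))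
             \<le> upper_const * rho ^ m / sqrt m"
    using gauss_approx_complex[OF m] by blast
  obtain p where p: "\<And>k. degree (p k) \<le> k" "\<And>k \<tau>. poly (p k) (1 / (1 + \<tau>\<^sup>2)) = Re (cayley (of_real \<tau>) ^ k)"
    using Re_cayley_power_poly by metis
  define Q where "Q = [:Re A:] + (\<Sum>k=1..m. smult (Re (d k)) (p k))"
  have "degree Q \<le> m"
    unfolding Q_def
    by (intro degree_add_le degree_sum_le order_trans[OF degree_smult_le] order_trans[OF p(1)]) auto
  moreover have "\<bar>exp (- (real m / sqrt 2) * \<tau>\<^sup>2) - poly Q (1 / (1 + \<tau>\<^sup>2))\<bar>
             \<le> upper_const * rho ^ m / sqrt m" for \<tau>
  proof -
    have "exp (- (real m / sqrt 2) * \<tau>\<^sup>2) - poly Q (1 / (1 + \<tau>\<^sup>2)) =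
      Re (gauss m (of_real \<tau>) - (A + (\<Sum>k=1..m. d k * of_real (Re (cayley (of_real \<tau>) ^ k)))))"
      unfolding Q_def gauss_real by (simp add: poly_sum p(2))
    then show ?thesis using order_trans[OF abs_Re_le_cmod Ad[of \<tau>]] by (simp only:)
  qed
  ultimately show ?thesis by blast
qed

section \<open>Orthogonality and Fourier coefficients\<close>

text \<open>The integrand has the primitive \<open>cayley \<tau> ^ k / (i k)\<close>, and \<open>cayley\<close> tends to \<open>- 1\<close> at both ends of
the real line.\<close>

lemma has_bochner_integral_cayley_power:
  assumes k: "k \<ge> 1"
  shows "has_bochner_integral lborel (\<lambda>\<tau>::real. cayley (of_real \<tau>) ^ k * of_real (2 / (1 + \<tau>\<^sup>2))) 0"
proof -
  let ?v = "\<lambda>\<tau>::real. cayley (of_real \<tau>)"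
  let ?f = "\<lambda>\<tau>::real. ?v \<tau> ^ k * of_real (2 / (1 + \<tau>\<^sup>2))"
  have nz: "1 + \<tau>\<^sup>2 \<noteq> 0" for \<tau> :: real
    using add_pos_nonneg[of 1 "\<tau>\<^sup>2"] by simp
  have dv: "(?v has_vector_derivative \<i> * ?v \<tau> * of_real (2 / (1 + \<tau>\<^sup>2))) (at \<tau>)" for \<tau>
    using has_vector_derivative_real_field[OF has_derivative_cayley[of "of_real \<tau>"]]
    by (simp add: mult_ac)
  have cv: "continuous_on UNIV ?v"
    using dv by (intro continuous_at_imp_continuous_on) (blast intro: has_vector_derivative_continuous)
  have cont: "continuous_on UNIV ?f"
    by (intro continuous_intros cv) (use nz in auto)
  have int: "integrable lborel ?f"
  proof (rule Bochner_Integration.integrable_bound)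
    show "integrable lborel (\<lambda>\<tau>::real. 2 * (1 / (1 + \<tau>\<^sup>2)))"
      using has_bochner_integral_inverse_one_plus_square
      by (intro integrable_mult_right) (auto simp: has_bochner_integral_iff)
    show "?f \<in> borel_measurable lborel"
      using borel_measurable_continuous_onI[OF cont] by simp
    show "AE \<tau> in lborel. norm (?f \<tau>) \<le> norm (2 * (1 / (1 + \<tau>\<^sup>2)))"
      unfolding norm_mult norm_power cayley_real(1) norm_of_real by simp
  qed
  have lim: "(\<lambda>n. ?v (c * real n)) \<longlonglongrightarrow> - 1" if c: "c \<noteq> 0" for c
  proof -
    have "(\<lambda>n. inverse (of_real (c * real n))) \<longlonglongrightarrow> (0 :: complex)"
    proof (rule tendsto_inverse_0[THEN filterlim_compose])
      show "LIM n sequentially. complex_of_real (c * real n) :> at_infinity"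
        unfolding of_real_mult using c
        by (intro tendsto_mult_filterlim_at_infinity[OF tendsto_const] filterlim_of_real_at_infinity[THEN filterlim_compose] filterlim_real_sequentially) auto
    qed
    then have "(\<lambda>n. (inverse (of_real (c * real n)) + \<i>) / (inverse (of_real (c * real n)) - \<i>)) \<longlonglongrightarrow> (0 + \<i>) / (0 - \<i>)"
      by (intro tendsto_intros) auto
    moreover have "\<forall>\<^sub>F n in sequentially. (inverse (of_real (c * real n)) + \<i>) / (inverse (of_real (c * real n)) - \<i>) = ?v (c * real n)"
      using eventually_gt_at_top[of 0]
    proof eventually_elim
      case (elim n)
      define s where "s = complex_of_real (c * real n)"
      have s: "s \<noteq> 0" "1 - \<i> * s \<noteq> 0" using elim c cayley_factors_nz(2)[of s] by (auto simp: s_def)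
      have "(inverse s + \<i>) / (inverse s - \<i>) = (s * (inverse s + \<i>)) / (s * (inverse s - \<i>))"
        using s by (subst mult_divide_mult_cancel_left) auto
      also have "\<dots> = cayley s" using s by (simp add: cayley_def distrib_left right_diff_distrib mult.commute)
      finally show ?case by (simp add: s_def)
    qed
    ultimately show ?thesis using Lim_transform_eventually by force
  qed
  have "integral\<^sup>L lborel ?f = 0"
  proof (rule integral_real_line_FTC[OF int cont, where F = "\<lambda>\<tau>. ?v \<tau> ^ k / (\<i> * of_nat k)"])
    fix \<tau>
    have pow: "((\<lambda>z. z ^ k) has_field_derivative of_nat k * z ^ (k - 1)) (at z)" for z :: complex
      by (auto intro!: derivative_eq_intros)
    have "((\<lambda>\<tau>. ?v \<tau> ^ k) has_vector_derivative of_nat k * (?v \<tau>) ^ (k - 1) * (\<i> * ?v \<tau> * of_real (2 / (1 + \<tau>\<^sup>2)))) (at \<tau>)"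
      using field_vector_diff_chain_at[OF dv[of \<tau>] pow[of "?v \<tau>"]] by (simp add: o_def mult_ac)
    then have "((\<lambda>\<tau>. ?v \<tau> ^ k / (\<i> * of_nat k)) has_vector_derivative of_nat k * (?v \<tau>) ^ (k - 1) * (\<i> * ?v \<tau> * of_real (2 / (1 + \<tau>\<^sup>2))) / (\<i> * of_nat k)) (at \<tau>)"
      by (rule has_vector_derivative_divide)
    also have "of_nat k * (?v \<tau>) ^ (k - 1) * (\<i> * ?v \<tau> * of_real (2 / (1 + \<tau>\<^sup>2))) / (\<i> * of_nat k) = ?f \<tau>"
    proof -
      have "?v \<tau> ^ k = ?v \<tau> ^ (k - 1) * ?v \<tau>" using k by (cases k) auto
      then show ?thesis using k by (simp add: mult_ac)
    qed
    finally show "((\<lambda>\<tau>. ?v \<tau> ^ k / (\<i> * of_nat k)) has_vector_derivative ?f \<tau>) (at \<tau>)" .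
  next
    have "(\<lambda>n. ?v (real n)) \<longlonglongrightarrow> - 1" "(\<lambda>n. ?v (- real n)) \<longlonglongrightarrow> - 1"
      using lim[of 1] lim[of "- 1"] by simp_all
    then have "(\<lambda>n. ?v (real n) ^ k / (\<i> * of_nat k) - ?v (- real n) ^ k / (\<i> * of_nat k)) \<longlonglongrightarrow> (- 1) ^ k / (\<i> * of_nat k) - (- 1) ^ k / (\<i> * of_nat k)"
      using k by (intro tendsto_intros) auto
    then show "(\<lambda>n. ?v (real n) ^ k / (\<i> * of_nat k) - ?v (- real n) ^ k / (\<i> * of_nat k)) \<longlonglongrightarrow> 0" by simp
  qed
  with int show ?thesis by (auto simp: has_bochner_integral_iff)
qed

lemma has_bochner_integral_cayley_poly:
  assumes k: "k \<ge> 1"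
  shows "has_bochner_integral lborel (\<lambda>\<tau>::real. cayley (of_real \<tau>) ^ k * poly p (cayley (of_real \<tau>)) * of_real (2 / (1 + \<tau>\<^sup>2))) 0"
proof -
  have "has_bochner_integral lborel (\<lambda>\<tau>::real. \<Sum>i\<le>degree p. coeff p i * (cayley (of_real \<tau>) ^ (k + i) * of_real (2 / (1 + \<tau>\<^sup>2)))) (\<Sum>i\<le>degree p. coeff p i * 0)"
    using k by (intro has_bochner_integral_sum has_bochner_integral_mult_right has_bochner_integral_cayley_power) auto
  then show ?thesis
    by (simp add: poly_altdef sum_distrib_left sum_distrib_right power_add mult_ac)
qed

text \<open>With \<open>v = cayley \<tau>\<close> one has \<open>1 / (1 - i \<tau>) = (v + 1) / 2\<close> and \<open>\<tau> / (1 - i \<tau>) = (v - 1) / (2 i)\<close>.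
So \<open>v ^ m\<close> times a function from \<open>restricted_rat m q\<close> is a polynomial in \<open>v\<close>, and the remaining factor
\<open>v ^ (k - m)\<close> removes its constant term.\<close>

lemma has_bochner_integral_rational_orthogonal:
  fixes P :: "real poly"
  assumes deg: "degree P \<le> m" and k: "m < k" and q: "q > 0"
  shows "has_bochner_integral lborel (\<lambda>\<tau>::real. of_real (poly P (- q * \<tau>\<^sup>2) / (q - (- q * \<tau>\<^sup>2)) ^ m) * cayley (of_real \<tau>) ^ k * of_real (2 / (1 + \<tau>\<^sup>2))) 0"
proof -
  define p :: "complex poly" where
    "p = (\<Sum>i\<le>m. smult (of_real (coeff P i * (- q) ^ i / q ^ m))
            (smult (- 1/4) ([:-1, 1:]\<^sup>2) ^ i * smult (1/4) ([:1, 1:]\<^sup>2) ^ (m - i)))"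
  have "of_real (poly P (- q * \<tau>\<^sup>2) / (q - (- q * \<tau>\<^sup>2)) ^ m) * cayley (of_real \<tau>) ^ k
      = cayley (of_real \<tau>) ^ (k - m) * poly p (cayley (of_real \<tau>))" for \<tau> :: real
  proof -
    define v where "v = cayley (of_real \<tau>)"
    define D where "D = 1 - \<i> * of_real \<tau>"
    have D0: "D \<noteq> 0" using cayley_factors_nz(2)[of "of_real \<tau>"] by (simp add: D_def)
    define N where "N = 1 + \<i> * of_real \<tau>"
    have N0: "N \<noteq> 0" using cayley_factors_nz(1)[of "of_real \<tau>"] by (simp add: N_def)
    have v: "v = N / D" by (simp add: v_def cayley_def N_def D_def)
    have vp: "v + 1 = 2 / D" unfolding v using D0 by (simp add: field_simps) (simp add: N_def D_def)
    have vm: "v - 1 = 2 * \<i> * of_real \<tau> / D" unfolding v using D0 by (simp add: field_simps) (simp add: N_def D_def)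
    have ND: "of_real (1 + \<tau>\<^sup>2) = N * D" by (simp add: N_def D_def algebra_simps power2_eq_square)
    have a: "- 1/4 * (v - 1)\<^sup>2 = of_real (\<tau>\<^sup>2) / D\<^sup>2" "1/4 * (v + 1)\<^sup>2 = 1 / D\<^sup>2"
      unfolding vp vm by (simp_all add: power_divide power_mult_distrib)
    have vD: "v / of_real (1 + \<tau>\<^sup>2) = 1 / D\<^sup>2"
      unfolding ND v using D0 N0 by (simp add: power2_eq_square)
    have main: "of_real (poly P (- q * \<tau>\<^sup>2) / (q - (- q * \<tau>\<^sup>2)) ^ m) * v ^ m = poly p v"
    proof -
      have "poly P (- q * \<tau>\<^sup>2) = (\<Sum>i\<le>m. coeff P i * (- q * \<tau>\<^sup>2) ^ i)"
        unfolding poly_altdef using deg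
        by (intro sum.mono_neutral_left) (auto simp: coeff_eq_0)
      then have "of_real (poly P (- q * \<tau>\<^sup>2) / (q - (- q * \<tau>\<^sup>2)) ^ m) * v ^ m
        = (\<Sum>i\<le>m. of_real (coeff P i * (- q * \<tau>\<^sup>2) ^ i / (q * (1 + \<tau>\<^sup>2)) ^ m) * v ^ m)"
        by (simp add: sum_divide_distrib sum_distrib_right distrib_left)
      also have "\<dots> = poly p v"
        unfolding p_def poly_sum
      proof (intro sum.cong refl)
        fix i assume "i \<in> {..m}"
        then have "D\<^sup>2 ^ m = D\<^sup>2 ^ i * D\<^sup>2 ^ (m - i)" by (simp flip: power_add)
        have "of_real (coeff P i * (- q * \<tau>\<^sup>2) ^ i / (q * (1 + \<tau>\<^sup>2)) ^ m) * v ^ m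
          = of_real (coeff P i * (- q) ^ i / q ^ m) * (of_real (\<tau>\<^sup>2) ^ i * (v / of_real (1 + \<tau>\<^sup>2)) ^ m)"
          unfolding power_mult_distrib[of "- q" "\<tau>\<^sup>2" i]
          by (simp add: power_mult_distrib power_divide del: of_real_add)
        also have "of_real (\<tau>\<^sup>2) ^ i * (v / of_real (1 + \<tau>\<^sup>2)) ^ m = (- 1/4 * (v - 1)\<^sup>2) ^ i * (1/4 * (v + 1)\<^sup>2) ^ (m - i)"
          unfolding a vD using \<open>D\<^sup>2 ^ m = _\<close> by (simp add: power_divide)
        finally show "of_real (coeff P i * (- q * \<tau>\<^sup>2) ^ i / (q * (1 + \<tau>\<^sup>2)) ^ m) * v ^ m
          = poly (smult (of_real (coeff P i * (- q) ^ i / q ^ m))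
            (smult (- 1/4) ([:-1, 1:]\<^sup>2) ^ i * smult (1/4) ([:1, 1:]\<^sup>2) ^ (m - i))) v"
          by (simp add: poly_power algebra_simps)
      qed
      finally show ?thesis .
    qed
    have "v ^ k = v ^ m * v ^ (k - m)" using k by (simp flip: power_add)
    then show ?thesis unfolding v_def[symmetric] main[symmetric] by simp
  qed
  then show ?thesis
    using has_bochner_integral_cayley_poly[of "k - m" p] k by simp
qed

text \<open>The \<open>k\<close>-th Fourier coefficient, up to normalisation, of \<open>exp (- (m / sqrt 2) * (tan (\<theta> / 2))\<^sup>2)\<close> as
a function of \<open>\<theta>\<close>; equivalently, a Chebyshev coefficient in the variable \<open>1 / (1 + \<tau>\<^sup>2)\<close>.\<close>

definition cheb_coeff :: "nat \<Rightarrow> nat \<Rightarrow> complex" where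
  "cheb_coeff m k = (\<integral>\<tau>. gauss m (of_real \<tau>) * cayley (of_real \<tau>) ^ k * of_real (2 / (1 + \<tau>\<^sup>2)) \<partial>lborel)"

lemma integrable_cheb:
  assumes m: "m > 0"
  shows "integrable lborel (\<lambda>\<tau>::real. gauss m (of_real \<tau>) * cayley (of_real \<tau>) ^ k * of_real (2 / (1 + \<tau>\<^sup>2)))"
proof -
  have 1: "1 + x\<^sup>2 \<noteq> 0" for x :: real using add_pos_nonneg[of 1 "x\<^sup>2"] by simp
  have "integrable lborel (\<lambda>x. gauss m (Complex x 0) * (cayley (Complex x 0) ^ k * of_real (2 / (1 + x\<^sup>2))))"
  proof (rule integrable_gauss_line[OF m])
    show "continuous_on UNIV (\<lambda>x. cayley (Complex x 0) ^ k * of_real (2 / (1 + x\<^sup>2)))"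
      by (intro continuous_intros continuous_cayley_line) (use 1 in auto)
    show "norm (cayley (Complex x 0) ^ k * of_real (2 / (1 + x\<^sup>2))) \<le> 2" for x
      unfolding complex_of_real_def[of x, symmetric] norm_mult norm_power cayley_real(1) norm_of_real
      using add_pos_nonneg[of 1 "x\<^sup>2"] by (simp add: divide_le_eq)
  qed
  then show ?thesis by (simp add: complex_of_real_def mult.assoc)
qed

lemma cheb_coeff_le_error:
  fixes P :: "real poly"
  assumes m: "m > 0" and deg: "degree P \<le> m" and k: "m < k" and q: "q > 0"
    and B: "\<And>\<tau>. \<bar>exp (- (real m / sqrt 2) * \<tau>\<^sup>2) - poly P (- q * \<tau>\<^sup>2) / (q - (- q * \<tau>\<^sup>2)) ^ m\<bar> \<le> B"
  shows "norm (cheb_coeff m k) \<le> 2 * pi * B"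
proof -
  let ?r = "\<lambda>\<tau>::real. poly P (- q * \<tau>\<^sup>2) / (q - (- q * \<tau>\<^sup>2)) ^ m"
  let ?w = "\<lambda>\<tau>::real. cayley (of_real \<tau>) ^ k * complex_of_real (2 / (1 + \<tau>\<^sup>2))"
  have r: "has_bochner_integral lborel (\<lambda>\<tau>. of_real (?r \<tau>) * ?w \<tau>) 0"
    using has_bochner_integral_rational_orthogonal[OF deg k q] by (simp only: mult.assoc)
  have g: "integrable lborel (\<lambda>\<tau>. gauss m (of_real \<tau>) * ?w \<tau>)"
    using integrable_cheb[OF m, of k] by (simp only: mult.assoc)
  have c: "cheb_coeff m k = (\<integral>\<tau>. (gauss m (of_real \<tau>) - of_real (?r \<tau>)) * ?w \<tau> \<partial>lborel)"
    using r g unfolding cheb_coeff_def left_diff_distrib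
    by (subst Bochner_Integration.integral_diff) (auto simp: has_bochner_integral_iff mult.assoc)
  have "norm (cheb_coeff m k) \<le> (\<integral>\<tau>. 2 * B * (1 / (1 + \<tau>\<^sup>2)) \<partial>lborel)"
    unfolding c
  proof (rule Bochner_Integration.integral_norm_bound_integral)
    show "integrable lborel (\<lambda>\<tau>. (gauss m (of_real \<tau>) - of_real (?r \<tau>)) * ?w \<tau>)"
      unfolding left_diff_distrib using r g by (intro Bochner_Integration.integrable_diff) (auto simp: has_bochner_integral_iff)
    show "integrable lborel (\<lambda>\<tau>. 2 * B * (1 / (1 + \<tau>\<^sup>2)))"
      using has_bochner_integral_inverse_one_plus_square
      by (intro integrable_mult_right) (auto simp: has_bochner_integral_iff)
    fix \<tau>
    have "norm ((gauss m (of_real \<tau>) - of_real (?r \<tau>)) * ?w \<tau>)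
        = \<bar>exp (- (real m / sqrt 2) * \<tau>\<^sup>2) - ?r \<tau>\<bar> * (2 / (1 + \<tau>\<^sup>2))"
      unfolding norm_mult norm_power cayley_real(1) gauss_real of_real_diff[symmetric] norm_of_real
      using add_pos_nonneg[of 1 "\<tau>\<^sup>2"] by simp
    also have "\<dots> \<le> B * (2 / (1 + \<tau>\<^sup>2))"
      using add_pos_nonneg[of 1 "\<tau>\<^sup>2"] by (intro mult_right_mono B) auto
    also have "B * (2 / (1 + \<tau>\<^sup>2)) = 2 * B * (1 / (1 + \<tau>\<^sup>2))" by simp
    finally show "norm ((gauss m (of_real \<tau>) - of_real (?r \<tau>)) * ?w \<tau>) \<le> 2 * B * (1 / (1 + \<tau>\<^sup>2))" .
  qed
  also have "\<dots> = 2 * B * pi"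
    using has_bochner_integral_inverse_one_plus_square
    by (subst Bochner_Integration.integral_mult_right_zero) (auto simp: has_bochner_integral_iff)
  finally show ?thesis by (simp add: mult_ac)
qed

section \<open>Moving the Fourier coefficients to the saddle line\<close>

text \<open>The contribution of the saddle point in the right half-plane; the other one contributes the
conjugate.\<close>

definition saddle_half :: "nat \<Rightarrow> nat \<Rightarrow> complex" where
  "saddle_half m k = (\<integral>x. indicator {0<..} x *\<^sub>R
     (gauss m (Complex x saddle_im) * cayley (Complex x saddle_im) ^ k * (2 / (1 + (Complex x saddle_im)\<^sup>2))) \<partial>lborel)"

lemma norm_cayley_power_over_le:
  assumes "0 \<le> y" "y < 1" "k \<ge> 1"
  shows "norm (cayley (Complex x y) ^ k * (2 / (1 + (Complex x y)\<^sup>2))) \<le> 2 / (1 + x\<^sup>2)"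
proof -
  let ?u = "Complex x y"
  have "cayley ?u ^ k * (2 / (1 + ?u\<^sup>2)) = cayley ?u ^ (k - 1) * (2 * (cayley ?u / (1 + ?u\<^sup>2)))"
    using assms(3) by (cases k) auto
  then have "norm (cayley ?u ^ k * (2 / (1 + ?u\<^sup>2))) = norm (cayley ?u) ^ (k - 1) * (2 * norm (cayley ?u / (1 + ?u\<^sup>2)))"
    by (simp only: norm_mult norm_power norm_numeral)
  also have "\<dots> \<le> 1 * (2 * (1 / (1 + x\<^sup>2)))"
    using assms by (intro mult_mono power_le_one norm_cayley_le_1 norm_cayley_over_le) auto
  finally show ?thesis by simp
qed

lemma integrable_saddle_line:
  assumes m: "m > 0" and k: "k \<ge> 1"
  shows "integrable lborel (\<lambda>x. gauss m (Complex x saddle_im) * cayley (Complex x saddle_im) ^ k * (2 / (1 + (Complex x saddle_im)\<^sup>2)))"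
  unfolding mult.assoc
proof (rule integrable_gauss_line[OF m])
  show "continuous_on UNIV (\<lambda>x. cayley (Complex x saddle_im) ^ k * (2 / (1 + (Complex x saddle_im)\<^sup>2)))"
    using cayley_factors_nz(3)[of "Complex _ saddle_im"] saddle_im
    by (intro continuous_intros continuous_cayley_line) auto
  fix x :: real
  have "2 / (1 + x\<^sup>2) \<le> 2"
    using add_pos_nonneg[of 1 "x\<^sup>2"] by (simp add: divide_le_eq)
  then show "norm (cayley (Complex x saddle_im) ^ k * (2 / (1 + (Complex x saddle_im)\<^sup>2))) \<le> 2"
    using norm_cayley_power_over_le[of saddle_im k x] saddle_im k by linarith
qed

lemma cheb_coeff_saddle_line:
  assumes m: "m > 0" and k: "k \<ge> 1"
  shows "cheb_coeff m k = (\<integral>x. gauss m (Complex x saddle_im) * cayley (Complex x saddle_im) ^ k * (2 / (1 + (Complex x saddle_im)\<^sup>2)) \<partial>lborel)"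
proof -
  define g where "g u = gauss m u * cayley u ^ k * (2 / (1 + u\<^sup>2))" for u
  have g0: "g (Complex x 0) = gauss m (of_real x) * cayley (of_real x) ^ k * of_real (2 / (1 + x\<^sup>2))" for x
    by (simp add: g_def complex_of_real_def[symmetric])
  have i0: "integrable lborel (\<lambda>x. g (Complex x 0))"
    unfolding g0 by (rule integrable_cheb[OF m])
  have i1: "integrable lborel (\<lambda>x. g (Complex x saddle_im))"
    unfolding g_def by (rule integrable_saddle_line[OF m k])
  have diff: "g field_differentiable at u" if "- 1 < Im u" "Im u < 1" for u
  proof -
    have "gauss m field_differentiable at u" "cayley field_differentiable at u"
      using gauss_has_derivative has_derivative_cayley[OF that] field_differentiable_def by blast+
    then show ?thesis
      unfolding g_def using cayley_factors_nz(3)[OF that] by (intro derivative_intros) auto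
  qed
  have "(\<integral>x. g (Complex x 0) - g (Complex x saddle_im) \<partial>lborel) = 0"
  proof (rule integral_horizontal_line_shift[where a = "- 1" and b = 1 and K = "{}" and R = 1
        and C = "exp (real m / sqrt 2) * 2"])
    show "continuous_on {u. - 1 < Im u \<and> Im u < 1} g"
      using diff field_differentiable_imp_continuous_at
      by (intro continuous_at_imp_continuous_on) blast
    fix x y :: real assume x: "1 \<le> \<bar>x\<bar>" and y: "0 \<le> y" "y \<le> saddle_im"
    have y1: "y < 1" using y saddle_im by simp
    have "norm (gauss m (Complex x y)) \<le> exp (real m / sqrt 2)"
    proof -
      have "y\<^sup>2 - x\<^sup>2 \<le> 1" using power_le_one[of y 2] y y1 zero_le_power2[of x] by linarith
      then have "real m / sqrt 2 * (y\<^sup>2 - x\<^sup>2) \<le> real m / sqrt 2 * 1" by (intro mult_left_mono) auto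
      then show ?thesis by (simp add: norm_gauss)
    qed
    moreover have "norm (cayley (Complex x y) ^ k * (2 / (1 + (Complex x y)\<^sup>2))) \<le> 2 / \<bar>x\<bar>"
    proof -
      have "\<bar>x\<bar> * 1 \<le> \<bar>x\<bar> * \<bar>x\<bar>" using x by (intro mult_left_mono) auto
      then have "\<bar>x\<bar> \<le> 1 + x\<^sup>2" by (simp add: power2_eq_square)
      then have "2 / (1 + x\<^sup>2) \<le> 2 / \<bar>x\<bar>" using x by (intro divide_left_mono) (auto intro!: mult_pos_pos add_pos_nonneg)
      then show ?thesis using norm_cayley_power_over_le[OF y(1) y1 k, of x] by linarith
    qed
    ultimately have "norm (gauss m (Complex x y)) * norm (cayley (Complex x y) ^ k * (2 / (1 + (Complex x y)\<^sup>2)))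
        \<le> exp (real m / sqrt 2) * (2 / \<bar>x\<bar>)"
      by (intro mult_mono) auto
    then show "norm (g (Complex x y)) \<le> exp (real m / sqrt 2) * 2 / \<bar>x\<bar>"
      unfolding g_def mult.assoc norm_mult[of "gauss m (Complex x y)"] by simp
  qed (use saddle_im diff i0 i1 in auto)
  then have "(\<integral>x. g (Complex x 0) \<partial>lborel) = (\<integral>x. g (Complex x saddle_im) \<partial>lborel)"
    using i0 i1 by simp
  then show ?thesis unfolding g0 cheb_coeff_def[symmetric] by (simp add: g_def)
qed

lemma cheb_coeff_eq_half:
  assumes m: "m > 0" and k: "k \<ge> 1"
  shows "cheb_coeff m k = of_real (2 * Re (saddle_half m k))"
proof -
  define g where "g x = gauss m (Complex x saddle_im) * cayley (Complex x saddle_im) ^ k * (2 / (1 + (Complex x saddle_im)\<^sup>2))" for x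
  have int: "integrable lborel g"
    unfolding g_def by (rule integrable_saddle_line[OF m k])
  define f where "f x = indicator {0<..} x *\<^sub>R g x" for x :: real
  have f: "integrable lborel f"
    unfolding f_def by (rule integrable_mult_indicator[OF _ int]) simp
  have refl: "g (- x) = cnj (g x)" for x
  proof -
    let ?u = "Complex x saddle_im"
    have "Complex (- x) saddle_im = - cnj ?u" by (simp add: complex_eq_iff)
    moreover have "gauss m (- cnj ?u) = cnj (gauss m ?u)"
      by (simp add: gauss_def exp_cnj)
    moreover have "cayley (- cnj ?u) = cnj (cayley ?u)"
      by (simp add: cayley_def)
    ultimately show ?thesis by (simp add: g_def)
  qed
  have fm: "integrable lborel (\<lambda>x. f (- x))"
    using lborel_integrable_real_affine[OF f, of "- 1" 0] by simp
  have "(\<integral>x. f x + cnj (f (- x)) \<partial>lborel) = integral\<^sup>L lborel g"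
  proof (rule integral_cong_AE)
    have "AE x in lborel. x \<noteq> (0::real)" by (rule AE_lborel_singleton)
    then show "AE x in lborel. f x + cnj (f (- x)) = g x"
      by eventually_elim (auto simp: f_def refl split: split_indicator)
    show "(\<lambda>x. f x + cnj (f (- x))) \<in> borel_measurable lborel"
      using f fm by (intro borel_measurable_integrable Bochner_Integration.integrable_add integrable_cnj)
  qed (use int in auto)
  moreover have "(\<integral>x. f (- x) \<partial>lborel) = integral\<^sup>L lborel f"
    using lborel_integral_real_affine[of "- 1" f 0] by simp
  ultimately have "integral\<^sup>L lborel g = integral\<^sup>L lborel f + cnj (integral\<^sup>L lborel f)"
    using f fm by simp
  also have "\<dots> = of_real (2 * Re (integral\<^sup>L lborel f))"
    by (rule complex_add_cnj)
  finally show ?thesis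
    unfolding cheb_coeff_saddle_line[OF m k] saddle_half_def f_def g_def .
qed

text \<open>The mean value inequality applied to \<open>f z - c / 2 * (z - z0)\<^sup>2\<close>, whose derivative is \<open>o(z - z0)\<close>.\<close>

lemma second_order_limit:
  fixes f f' :: "complex \<Rightarrow> complex"
  assumes r: "r > 0" and f: "\<And>z. z \<in> ball z0 r \<Longrightarrow> (f has_field_derivative f' z) (at z)"
    and f'0: "f' z0 = 0" and f'': "(f' has_field_derivative c) (at z0)"
  shows "((\<lambda>d. (f (z0 + d) - f z0) / d\<^sup>2) \<longlongrightarrow> c / 2) (at 0)"
  unfolding tendsto_iff
proof (intro allI impI)
  fix e :: real assume e: "e > 0"
  from f'' have "((\<lambda>z. (f' z - f' z0) / (z - z0)) \<longlongrightarrow> c) (at z0)"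
    by (simp add: has_field_derivative_iff)
  then obtain \<delta> where \<delta>: "\<delta> > 0"
    "\<And>z. z \<noteq> z0 \<Longrightarrow> dist z z0 < \<delta> \<Longrightarrow> dist ((f' z - f' z0) / (z - z0)) c < e / 2"
    using e unfolding tendsto_iff eventually_at by (metis (mono_tags, lifting) UNIV_I half_gt_zero)
  have bound: "norm (f' z - c * (z - z0)) \<le> e / 2 * norm (z - z0)" if "dist z z0 < \<delta>" for z
  proof (cases "z = z0")
    case False
    then have "f' z - c * (z - z0) = ((f' z - f' z0) / (z - z0) - c) * (z - z0)"
      using f'0 by (simp add: field_simps)
    then have "norm (f' z - c * (z - z0)) = norm ((f' z - f' z0) / (z - z0) - c) * norm (z - z0)"
      by (simp only: norm_mult)
    also have "\<dots> \<le> e / 2 * norm (z - z0)"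
      using \<delta>(2)[OF False that] by (intro mult_right_mono) (auto simp: dist_norm)
    finally show ?thesis .
  qed (use f'0 in auto)
  show "\<forall>\<^sub>F d in at 0. dist ((f (z0 + d) - f z0) / d\<^sup>2) (c / 2) < e"
    unfolding eventually_at
  proof (intro exI[of _ "min r \<delta>"] conjI ballI impI)
    fix d :: complex assume "d \<noteq> 0 \<and> dist d 0 < min r \<delta>"
    then have d: "d \<noteq> 0" "norm d < r" "norm d < \<delta>" by auto
    define h where "h z = f z - c / 2 * (z - z0)\<^sup>2" for z
    have "norm (h (z0 + d) - h z0) \<le> (e / 2 * norm d) * norm (z0 + d - z0)"
    proof (rule field_differentiable_bound[where S = "cball z0 (norm d)" and f' = "\<lambda>z. f' z - c * (z - z0)"])
      fix z assume z: "z \<in> cball z0 (norm d)"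
      then have "(h has_field_derivative f' z - c / 2 * (2 * (z - z0))) (at z)"
        unfolding h_def using d by (auto intro!: derivative_eq_intros f)
      also have "c / 2 * (2 * (z - z0)) = c * (z - z0)" by simp
      finally show "(h has_field_derivative f' z - c * (z - z0)) (at z within cball z0 (norm d))"
        by (rule has_field_derivative_at_within)
      have "norm (z - z0) \<le> norm d" using z by (simp add: dist_norm norm_minus_commute)
      moreover have "norm (f' z - c * (z - z0)) \<le> e / 2 * norm (z - z0)"
        using z d by (intro bound) (auto simp: dist_commute)
      ultimately show "norm (f' z - c * (z - z0)) \<le> e / 2 * norm d"
        using e by (meson half_gt_zero less_eq_real_def mult_left_mono order_trans)
    qed (auto simp: dist_norm)
    then have b: "norm (h (z0 + d) - h z0) \<le> e / 2 * (norm d)\<^sup>2"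
      by (simp add: power2_eq_square mult_ac)
    have "(f (z0 + d) - f z0) / d\<^sup>2 - c / 2 = (h (z0 + d) - h z0) / d\<^sup>2"
      using d by (simp add: h_def field_simps)
    then have "dist ((f (z0 + d) - f z0) / d\<^sup>2) (c / 2) = norm (h (z0 + d) - h z0) / (norm d)\<^sup>2"
      by (simp only: dist_norm norm_divide norm_power)
    also have "\<dots> \<le> e / 2" using b d by (simp add: divide_le_eq)
    also have "\<dots> < e" using e by simp
    finally show "dist ((f (z0 + d) - f z0) / d\<^sup>2) (c / 2) < e" .
  qed (use r \<delta> in auto)
qed

section \<open>Laplace's method at the saddle points\<close>

text \<open>The factor whose \<open>m\<close>-th power dominates the Fourier coefficients.\<close>

definition saddle_fun :: "complex \<Rightarrow> complex" where
  "saddle_fun u = gauss 1 u * cayley u"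

definition saddle_pt :: complex where
  "saddle_pt = Complex saddle_im saddle_im"

text \<open>Half the second derivative at \<open>saddle_pt\<close> of the logarithm of \<open>saddle_fun\<close>.\<close>

definition saddle_curv :: complex where
  "saddle_curv = Complex (- sqrt 2) (- saddle_im)"

text \<open>A logarithm of \<open>saddle_fun\<close> on the strip \<open>\<bar>Im u\<bar> < 1\<close>: there \<open>1 + i u\<close> and \<open>1 - i u\<close> have positive
real parts.\<close>

definition saddle_log :: "complex \<Rightarrow> complex" where
  "saddle_log u = - of_real (1 / sqrt 2) * u\<^sup>2 + Ln (1 + \<i> * u) - Ln (1 - \<i> * u)"

lemma exp_saddle_log:
  assumes "- 1 < Im u" "Im u < 1"
  shows "exp (saddle_log u) = saddle_fun u"
  using cayley_factors_nz[OF assms]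
  unfolding saddle_log_def saddle_fun_def gauss_def cayley_def exp_diff exp_add by simp

lemma gauss_cayley_power: "gauss m u * cayley u ^ (m + j) = saddle_fun u ^ m * cayley u ^ j"
  by (subst gauss_power) (simp add: saddle_fun_def power_mult_distrib power_add)

lemma saddle_pt_square: "saddle_pt\<^sup>2 = \<i>"
  using saddle_im(3) by (simp add: saddle_pt_def complex_eq_iff power2_eq_square)

lemma saddle_pt_factors:
  "1 + \<i> * saddle_pt \<noteq> 0" "1 - \<i> * saddle_pt \<noteq> 0"
  "(1 + \<i> * saddle_pt) * (1 - \<i> * saddle_pt) = 1 + \<i>"
proof -
  show "1 + \<i> * saddle_pt \<noteq> 0" "1 - \<i> * saddle_pt \<noteq> 0"
    using cayley_factors_nz[of saddle_pt] saddle_im by (auto simp: saddle_pt_def)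
  show "(1 + \<i> * saddle_pt) * (1 - \<i> * saddle_pt) = 1 + \<i>"
    using saddle_pt_square by (simp flip: one_plus_square)
qed

lemma sqrt2_saddle_pt: "of_real (sqrt 2) * saddle_pt = 1 + \<i>"
  by (simp add: saddle_pt_def saddle_im_def complex_eq_iff)

text \<open>Raising the frequency by one multiplies the leading term of \<open>saddle_half\<close> by this purely imaginary
number.\<close>

lemma cayley_saddle_pt: "cayley saddle_pt = \<i> * of_real rho"
proof -
  have "1 + \<i> * saddle_pt = \<i> * of_real rho * (1 - \<i> * saddle_pt)"
    by (simp add: saddle_pt_def saddle_im_def rho_def complex_eq_iff algebra_simps)
  then show ?thesis
    using saddle_pt_factors(2) by (simp add: cayley_def divide_eq_eq)
qed

lemma norm_saddle_fun_pt: "norm (saddle_fun saddle_pt) = rho"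
  unfolding saddle_fun_def norm_mult cayley_saddle_pt
  using rho_pos by (simp add: saddle_pt_def norm_gauss)

lemma saddle_log_second_order:
  "((\<lambda>d. (saddle_log (saddle_pt + d) - saddle_log saddle_pt) / d\<^sup>2) \<longlongrightarrow> saddle_curv) (at 0)"
proof -
  let ?s = "complex_of_real (1 / sqrt 2)" and ?a = "1 + \<i> * saddle_pt" and ?b = "1 - \<i> * saddle_pt"
  let ?f' = "\<lambda>z. - ?s * (2 * z) + \<i> / (1 + \<i> * z) + \<i> / (1 - \<i> * z)"
  note nz = saddle_pt_factors(1,2) and ab = saddle_pt_factors(3)
  have s2: "?s * 2 = of_real (sqrt 2)"
  proof -
    have "1 / sqrt 2 * 2 = sqrt 2" by (simp add: real_div_sqrt)
    then show ?thesis by (metis of_real_mult of_real_numeral)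
  qed
  have "((\<lambda>d. (saddle_log (saddle_pt + d) - saddle_log saddle_pt) / d\<^sup>2) \<longlongrightarrow> (2 * saddle_curv) / 2) (at 0)"
  proof (rule second_order_limit[where r = "1 - saddle_im" and f' = ?f'])
    show "1 - saddle_im > 0" using saddle_im by simp
    fix z assume "z \<in> ball saddle_pt (1 - saddle_im)"
    then have "\<bar>Im z - saddle_im\<bar> < 1 - saddle_im"
      using abs_Im_le_cmod[of "z - saddle_pt"] by (simp add: saddle_pt_def dist_norm norm_minus_commute)
    then have z: "- 1 < Im z" "Im z < 1" using saddle_im by auto
    then have "1 + \<i> * z \<notin> \<real>\<^sub>\<le>\<^sub>0" "1 - \<i> * z \<notin> \<real>\<^sub>\<le>\<^sub>0"
      by (auto simp: complex_nonpos_Reals_iff)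
    then show "(saddle_log has_field_derivative ?f' z) (at z)"
      unfolding saddle_log_def by (auto intro!: derivative_eq_intros simp: divide_inverse)
  next
    have "\<i> / ?a + \<i> / ?b = \<i> * (?a + ?b) / (?a * ?b)"
      using nz by (simp add: field_simps)
    also have "\<dots> = 1 + \<i>"
    proof -
      have "1 + \<i> \<noteq> 0" by (simp add: complex_eq_iff)
      then show ?thesis unfolding ab by (simp add: divide_eq_eq algebra_simps)
    qed
    finally have "\<i> / ?a + \<i> / ?b = 1 + \<i>" .
    moreover have "?s * (2 * saddle_pt) = 1 + \<i>"
      unfolding mult.assoc[symmetric] s2 by (rule sqrt2_saddle_pt)
    ultimately show "?f' saddle_pt = 0" by (simp add: add.assoc)
  next
    have "(?f' has_field_derivative - ?s * 2 + 1 / ?a\<^sup>2 - 1 / ?b\<^sup>2) (at saddle_pt)"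
      using nz by (auto intro!: derivative_eq_intros simp: power2_eq_square)
    also have "- ?s * 2 + 1 / ?a\<^sup>2 - 1 / ?b\<^sup>2 = 2 * saddle_curv"
    proof -
      have "1 / a\<^sup>2 - 1 / b\<^sup>2 = (b\<^sup>2 - a\<^sup>2) / (a * b)\<^sup>2" if "a \<noteq> 0" "b \<noteq> 0" for a b :: complex
        using that by (simp add: field_simps power_mult_distrib)
      then have "1 / ?a\<^sup>2 - 1 / ?b\<^sup>2 = (?b\<^sup>2 - ?a\<^sup>2) / (?a * ?b)\<^sup>2"
        using nz by blast
      also have "?b\<^sup>2 - ?a\<^sup>2 = - 4 * \<i> * saddle_pt" by (simp add: power2_eq_square algebra_simps)
      also have "(?a * ?b)\<^sup>2 = 2 * \<i>" unfolding ab by (simp add: power2_eq_square algebra_simps)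
      also have "- 4 * \<i> * saddle_pt / (2 * \<i>) = - 2 * saddle_pt" by simp
      finally have "- ?s * 2 + 1 / ?a\<^sup>2 - 1 / ?b\<^sup>2 = - of_real (sqrt 2) - 2 * saddle_pt"
        using s2 by (simp add: algebra_simps)
      also have "\<dots> = 2 * saddle_curv"
        by (simp add: saddle_curv_def saddle_pt_def saddle_im_def complex_eq_iff)
      finally show ?thesis .
    qed
    finally show "(?f' has_field_derivative 2 * saddle_curv) (at saddle_pt)" .
  qed
  then show ?thesis by simp
qed

definition saddle_gauss_integral :: complex where
  "saddle_gauss_integral = (\<integral>y. exp (saddle_curv * of_real (y\<^sup>2)) \<partial>lborel)"

text \<open>Substituting \<open>x = saddle_im + y / sqrt m\<close> turns \<open>sqrt m * saddle_half m (m + j)\<close>, divided by the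
\<open>m\<close>-th power of the value at the saddle point, into an integral whose integrand converges pointwise
to a complex Gaussian. The bound \<open>norm_saddle_line\<close> becomes \<open>exp (- (rho / 4) * y\<^sup>2)\<close>, which does not
depend on \<open>m\<close> and makes the convergence dominated.\<close>

lemma saddle_half_asymptotics:
  assumes j: "j \<ge> 1"
  shows "(\<lambda>n. of_real (sqrt (Suc n)) * saddle_half (Suc n) (Suc n + j) / saddle_fun saddle_pt ^ Suc n)
     \<longlonglongrightarrow> saddle_gauss_integral * (cayley saddle_pt ^ j * (2 / (1 + saddle_pt\<^sup>2)))"
proof -
  let ?S0 = "saddle_fun saddle_pt"
  have S0: "?S0 \<noteq> 0" using norm_saddle_fun_pt rho_pos by auto
  define c where "c n = 1 / sqrt (real (Suc n))" for n
  have c0: "c n > 0" for n by (simp add: c_def)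
  define h where "h u = cayley u ^ j * (2 / (1 + u\<^sup>2))" for u
  define L where "L n x = saddle_fun (Complex x saddle_im) ^ Suc n * h (Complex x saddle_im)" for n x
  have L_eq: "L n x = gauss (Suc n) (Complex x saddle_im) * cayley (Complex x saddle_im) ^ (Suc n + j)
      * (2 / (1 + (Complex x saddle_im)\<^sup>2))" for n x
    unfolding L_def h_def mult.assoc[symmetric] gauss_cayley_power by (simp only: mult.assoc)
  define F where "F n x = indicator {0<..} x *\<^sub>R L n x" for n and x :: real
  have F_int: "integrable lborel (F n)" for n
    unfolding F_def L_eq
    by (rule integrable_mult_indicator, simp, rule integrable_saddle_line) auto
  define s where "s n y = F n (saddle_im + c n * y) / ?S0 ^ Suc n" for n and y :: real
  have "saddle_half (Suc n) (Suc n + j) = c n *\<^sub>R (\<integral>y. F n (saddle_im + c n * y) \<partial>lborel)" for n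
    using lborel_integral_real_affine[of "c n" "F n" saddle_im] c0[of n]
    by (simp add: saddle_half_def F_def L_eq del: power_Suc add_Suc)
  moreover have "sqrt (Suc n) * c n = 1" for n
    by (simp add: c_def)
  ultimately have scaled: "of_real (sqrt (Suc n)) * saddle_half (Suc n) (Suc n + j) / ?S0 ^ Suc n = integral\<^sup>L lborel (s n)" for n
    unfolding s_def by (simp add: scaleR_conv_of_real flip: of_real_mult mult.assoc del: power_Suc add_Suc)
  have pt: "Complex (saddle_im + d) saddle_im = saddle_pt + of_real d" for d
    by (simp add: saddle_pt_def complex_eq_iff)
  have "(\<lambda>n. integral\<^sup>L lborel (s n)) \<longlonglongrightarrow> (\<integral>y. exp (saddle_curv * of_real (y\<^sup>2)) * h saddle_pt \<partial>lborel)"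
  proof (rule integral_dominated_convergence[where w = "\<lambda>y. 2 * exp (- (rho / 4) * (y - 0)\<^sup>2)"])
    have "continuous_on UNIV (\<lambda>y::real. exp (saddle_curv * of_real (y\<^sup>2)) * h saddle_pt)"
      by (intro continuous_intros)
    then show "(\<lambda>y. exp (saddle_curv * of_real (y\<^sup>2)) * h saddle_pt) \<in> borel_measurable lborel"
      using borel_measurable_continuous_onI by simp
    show "s n \<in> borel_measurable lborel" for n
      unfolding s_def using lborel_integrable_real_affine[OF F_int[of n], of "c n" saddle_im] c0[of n] by auto
    show "integrable lborel (\<lambda>y. 2 * exp (- (rho / 4) * (y - 0)\<^sup>2))"
      using has_bochner_integral_gaussian[of "rho / 4" 0] rho_pos
      by (intro integrable_mult_right) (auto simp: has_bochner_integral_iff)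
  next
    fix n
    show "AE y in lborel. norm (s n y) \<le> 2 * exp (- (rho / 4) * (y - 0)\<^sup>2)"
    proof (rule AE_I2)
      fix y
      let ?x = "saddle_im + c n * y"
      let ?u = "Complex ?x saddle_im"
      show "norm (s n y) \<le> 2 * exp (- (rho / 4) * (y - 0)\<^sup>2)"
      proof (cases "?x > 0")
        case True
        have e: "real (Suc n) * (\<bar>?x\<bar> - saddle_im)\<^sup>2 = (y - 0)\<^sup>2"
          using True by (simp add: c_def power_mult_distrib power_divide del: of_nat_Suc)
        have "norm (saddle_fun ?u ^ Suc n) = norm (gauss (Suc n) ?u * cayley ?u ^ Suc n)"
          using gauss_cayley_power[of "Suc n" ?u 0] by simp
        also have "\<dots> \<le> rho ^ Suc n * exp (- (rho / 4) * real (Suc n) * (\<bar>?x\<bar> - saddle_im)\<^sup>2)"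
          by (rule norm_saddle_line)
        also have "\<dots> = rho ^ Suc n * exp (- (rho / 4) * (y - 0)\<^sup>2)"
          unfolding mult.assoc e ..
        finally have 1: "norm (saddle_fun ?u ^ Suc n) \<le> rho ^ Suc n * exp (- (rho / 4) * (y - 0)\<^sup>2)" .
        have "2 / (1 + ?x\<^sup>2) \<le> 2"
          using add_pos_nonneg[of 1 "?x\<^sup>2"] by (simp add: divide_le_eq)
        then have 2: "norm (h ?u) \<le> 2"
          unfolding h_def using norm_cayley_power_over_le[of saddle_im j ?x] saddle_im j by linarith
        have "norm (s n y) = norm (saddle_fun ?u ^ Suc n) * norm (h ?u) / rho ^ Suc n"
          using True by (simp only: s_def F_def L_def norm_divide norm_mult norm_power[of ?S0] norm_saddle_fun_pt) (simp add: norm_mult)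
        also have "\<dots> \<le> (rho ^ Suc n * exp (- (rho / 4) * (y - 0)\<^sup>2)) * 2 / rho ^ Suc n"
          using rho_pos by (intro divide_right_mono mult_mono 1 2) auto
        also have "\<dots> = 2 * exp (- (rho / 4) * (y - 0)\<^sup>2)"
          using rho_pos by simp
        finally show ?thesis .
      qed (simp add: s_def F_def)
    qed
  next
    show "AE y in lborel. (\<lambda>n. s n y) \<longlonglongrightarrow> exp (saddle_curv * of_real (y\<^sup>2)) * h saddle_pt"
    proof (rule AE_I2)
      fix y :: real
      let ?d = "\<lambda>n. complex_of_real (c n * y)"
      have "c \<longlonglongrightarrow> 0"
        unfolding c_def by real_asymp
      then have cy: "(\<lambda>n. c n * y) \<longlonglongrightarrow> 0"
        using tendsto_mult_left_zero by blast
      then have d0: "?d \<longlonglongrightarrow> 0"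
        using tendsto_of_real by fastforce
      then have ul: "(\<lambda>n. saddle_pt + ?d n) \<longlonglongrightarrow> saddle_pt"
        using tendsto_add[OF tendsto_const d0] by simp
      have nz: "1 + saddle_pt\<^sup>2 \<noteq> 0" "1 - \<i> * saddle_pt \<noteq> 0"
        using saddle_pt_factors by (auto simp: one_plus_square)
      have hl: "(\<lambda>n. h (saddle_pt + ?d n)) \<longlonglongrightarrow> h saddle_pt"
        unfolding h_def cayley_def using nz by (intro tendsto_intros ul) auto
      have "(\<lambda>n. of_nat (Suc n) * (saddle_log (saddle_pt + ?d n) - saddle_log saddle_pt)) \<longlonglongrightarrow> saddle_curv * of_real (y\<^sup>2)"
      proof (cases "y = 0")
        case False
        have "filterlim ?d (at 0) sequentially"
          using d0 False c0 by (auto simp: filterlim_at less_imp_neq[THEN not_sym])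
        then have "(\<lambda>n. (saddle_log (saddle_pt + ?d n) - saddle_log saddle_pt) / (?d n)\<^sup>2) \<longlonglongrightarrow> saddle_curv"
          by (rule filterlim_compose[OF saddle_log_second_order])
        then have "(\<lambda>n. (saddle_log (saddle_pt + ?d n) - saddle_log saddle_pt) / (?d n)\<^sup>2 * of_real (y\<^sup>2)) \<longlonglongrightarrow> saddle_curv * of_real (y\<^sup>2)"
          by (intro tendsto_intros)
        moreover have "A / (?d n)\<^sup>2 * of_real (y\<^sup>2) = of_nat (Suc n) * A" for n A
        proof -
          have "y\<^sup>2 / (c n * y)\<^sup>2 = real (Suc n)"
            using False by (simp add: c_def power_mult_distrib power_divide del: of_nat_Suc)
          then have "complex_of_real (y\<^sup>2 / (c n * y)\<^sup>2) = of_real (real (Suc n))" by (rule arg_cong)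
          then have "of_real (y\<^sup>2) / (?d n)\<^sup>2 = of_nat (Suc n)"
            by (simp only: of_real_divide of_real_power of_real_of_nat_eq)
          moreover have "A / (?d n)\<^sup>2 * of_real (y\<^sup>2) = of_real (y\<^sup>2) / (?d n)\<^sup>2 * A" by simp
          ultimately show ?thesis by (simp only:)
        qed
        ultimately show ?thesis by (simp only:)
      qed simp
      then have el: "(\<lambda>n. exp (of_nat (Suc n) * (saddle_log (saddle_pt + ?d n) - saddle_log saddle_pt))) \<longlonglongrightarrow> exp (saddle_curv * of_real (y\<^sup>2))"
        by (rule tendsto_exp)
      have "(\<lambda>n. exp (of_nat (Suc n) * (saddle_log (saddle_pt + ?d n) - saddle_log saddle_pt)) * h (saddle_pt + ?d n))
          \<longlonglongrightarrow> exp (saddle_curv * of_real (y\<^sup>2)) * h saddle_pt"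
        by (intro tendsto_mult el hl)
      moreover have "\<forall>\<^sub>F n in sequentially. exp (of_nat (Suc n) * (saddle_log (saddle_pt + ?d n) - saddle_log saddle_pt)) * h (saddle_pt + ?d n) = s n y"
      proof -
        have "\<forall>\<^sub>F n in sequentially. c n * y > - saddle_im"
          using order_tendstoD(1)[OF cy, of "- saddle_im"] saddle_im by simp
        then show ?thesis
        proof eventually_elim
          case (elim n)
          have 1: "exp (saddle_log (saddle_pt + ?d n)) = saddle_fun (saddle_pt + ?d n)"
            "exp (saddle_log saddle_pt) = ?S0"
            using saddle_im by (auto intro!: exp_saddle_log simp: saddle_pt_def)
          have "exp (of_nat (Suc n) * (saddle_log (saddle_pt + ?d n) - saddle_log saddle_pt)) = (saddle_fun (saddle_pt + ?d n) / ?S0) ^ Suc n"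
            unfolding exp_of_nat_mult exp_diff 1 ..
          then show ?case
            using elim by (simp add: s_def F_def L_def pt power_divide del: power_Suc of_real_mult)
        qed
      qed
      ultimately show "(\<lambda>n. s n y) \<longlonglongrightarrow> exp (saddle_curv * of_real (y\<^sup>2)) * h saddle_pt"
        by (rule Lim_transform_eventually)
    qed
  qed
  then show ?thesis
    unfolding scaled saddle_gauss_integral_def h_def[symmetric]
    by (simp only: Bochner_Integration.integral_mult_left_zero)
qed

text \<open>The real part of the integrand is \<open>exp (- sqrt 2 * y\<^sup>2) * cos (y\<^sup>2 / sqrt 2)\<close>. By
\<open>cos x \<ge> 1 - x\<^sup>2 / 2\<close> its integral is at least a positive multiple of \<open>1 - E(Y ^ 4) / 4 = 1 - 3/32\<close>,
where \<open>Y\<close> is normal with mean 0 and variance \<open>1 / (2 * sqrt 2)\<close>.\<close>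

lemma saddle_gauss_integral_nz: "saddle_gauss_integral \<noteq> 0"
proof -
  define \<sigma> :: real where "\<sigma> = sqrt (1 / (2 * sqrt 2))"
  have \<sigma>: "\<sigma> > 0" "\<sigma>\<^sup>2 = 1 / (2 * sqrt 2)" by (auto simp: \<sigma>_def)
  let ?g = "\<lambda>y. exp (- sqrt 2 * y\<^sup>2)"
  have nd: "?g y = sqrt (2 * pi * \<sigma>\<^sup>2) * normal_density 0 \<sigma> y" for y
    by (simp add: normal_density_def \<sigma> real_sqrt_divide)
  have m0: "has_bochner_integral lborel (normal_density 0 \<sigma>) 1"
    using normal_moment_even[OF \<sigma>(1), of 0 0] by simp
  have m4: "has_bochner_integral lborel (\<lambda>y. normal_density 0 \<sigma> y * y ^ 4) (3 / 8)"
    using normal_moment_even[OF \<sigma>(1), of 0 2] by (simp add: \<sigma> fact_numeral power_divide power_mult_distrib)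
  have int: "integrable lborel (\<lambda>y. exp (saddle_curv * of_real (y\<^sup>2)))"
  proof (rule Bochner_Integration.integrable_bound)
    show "integrable lborel (\<lambda>y. exp (- sqrt 2 * (y - 0)\<^sup>2))"
      using has_bochner_integral_gaussian[of "sqrt 2" 0] by (auto simp: has_bochner_integral_iff)
    have "continuous_on UNIV (\<lambda>y::real. exp (saddle_curv * of_real (y\<^sup>2)))"
      by (intro continuous_intros)
    then show "(\<lambda>y. exp (saddle_curv * of_real (y\<^sup>2))) \<in> borel_measurable lborel"
      using borel_measurable_continuous_onI by simp
  qed (auto simp: saddle_curv_def)
  have lower: "has_bochner_integral lborel (\<lambda>y. sqrt (2 * pi * \<sigma>\<^sup>2) * (normal_density 0 \<sigma> y - 1/4 * (normal_density 0 \<sigma> y * y ^ 4)))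
      (sqrt (2 * pi * \<sigma>\<^sup>2) * (1 - 1/4 * (3/8)))"
    by (intro has_bochner_integral_mult_right has_bochner_integral_diff m0 m4)
  have "0 < sqrt (2 * pi * \<sigma>\<^sup>2) * (1 - 1/4 * (3/8))"
    using \<sigma> by simp
  also have "\<dots> = (\<integral>y. sqrt (2 * pi * \<sigma>\<^sup>2) * (normal_density 0 \<sigma> y - 1/4 * (normal_density 0 \<sigma> y * y ^ 4)) \<partial>lborel)"
    using lower by (simp add: has_bochner_integral_iff)
  also have "\<dots> \<le> (\<integral>y. Re (exp (saddle_curv * of_real (y\<^sup>2))) \<partial>lborel)"
  proof (rule integral_mono)
    show "integrable lborel (\<lambda>y. Re (exp (saddle_curv * of_real (y\<^sup>2))))" using int by (rule integrable_Re)
    fix y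
    have "cos x \<ge> 1 - x\<^sup>2 / 2" for x :: real
      using cos_double_sin[of "x / 2"] abs_sin_x_le_abs_x[of "x / 2"] power_mono[of "\<bar>sin (x/2)\<bar>" "\<bar>x/2\<bar>" 2]
      by (simp add: power_divide)
    from this[of "saddle_im * y\<^sup>2"] have "cos (saddle_im * y\<^sup>2) \<ge> 1 - 1/4 * y ^ 4"
      using saddle_im(3) by (simp add: power_mult_distrib)
    then have "?g y * (1 - 1/4 * y ^ 4) \<le> ?g y * cos (saddle_im * y\<^sup>2)"
      by (intro mult_left_mono) auto
    also have "?g y * cos (saddle_im * y\<^sup>2) = Re (exp (saddle_curv * of_real (y\<^sup>2)))"
      by (simp add: Re_exp saddle_curv_def)
    finally show "sqrt (2 * pi * \<sigma>\<^sup>2) * (normal_density 0 \<sigma> y - 1/4 * (normal_density 0 \<sigma> y * y ^ 4)) \<le> Re (exp (saddle_curv * of_real (y\<^sup>2)))"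
      unfolding nd by (simp add: algebra_simps)
  qed (use lower in \<open>auto simp: has_bochner_integral_iff\<close>)
  also have "\<dots> = Re saddle_gauss_integral"
    unfolding saddle_gauss_integral_def using int by (rule integral_Re)
  finally show ?thesis by auto
qed

text \<open>A single coefficient is \<open>2 * Re\<close> of a complex number of modulus about \<open>rho ^ m / sqrt m\<close> whose
argument turns with \<open>m\<close>, so it may be much smaller than that. The numbers for \<open>m + 1\<close> and \<open>m + 2\<close>
differ asymptotically by the factor \<open>i * rho\<close>, hence the real part of the second recovers the
imaginary part of the first.\<close>

lemma cheb_coeff_lower:
  "\<exists>c>0. \<forall>\<^sub>F m in sequentially. c * rho ^ m / sqrt m \<le> norm (cheb_coeff m (m + 1)) + norm (cheb_coeff m (m + 2))"
proof -
  let ?S0 = "saddle_fun saddle_pt"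
  define A where "A = saddle_gauss_integral * (cayley saddle_pt ^ 1 * (2 / (1 + saddle_pt\<^sup>2)))"
  have nzc: "cayley saddle_pt \<noteq> 0" using rho_pos by (simp add: cayley_saddle_pt)
  have A0: "A \<noteq> 0"
    using saddle_gauss_integral_nz nzc saddle_pt_factors by (auto simp: A_def one_plus_square)
  define a where "a n = of_real (sqrt (Suc n)) * saddle_half (Suc n) (Suc n + 1) / ?S0 ^ Suc n" for n
  define b where "b n = of_real (sqrt (Suc n)) * saddle_half (Suc n) (Suc n + 2) / ?S0 ^ Suc n" for n
  have a: "a \<longlonglongrightarrow> A"
    unfolding a_def A_def by (rule saddle_half_asymptotics) simp
  have "b \<longlonglongrightarrow> saddle_gauss_integral * (cayley saddle_pt ^ 2 * (2 / (1 + saddle_pt\<^sup>2)))"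
    unfolding b_def by (rule saddle_half_asymptotics) simp
  also have "saddle_gauss_integral * (cayley saddle_pt ^ 2 * (2 / (1 + saddle_pt\<^sup>2))) = \<i> * of_real rho * A"
    by (simp add: A_def cayley_saddle_pt power2_eq_square)
  finally have b: "b \<longlonglongrightarrow> \<i> * of_real rho * A" .
  have "(\<lambda>n. rho * norm (a n) - norm (b n - \<i> * of_real rho * a n)) \<longlonglongrightarrow>
      rho * norm A - norm (\<i> * of_real rho * A - \<i> * of_real rho * A)"
    by (intro tendsto_intros a b)
  then have "\<forall>\<^sub>F n in sequentially. rho * norm (a n) - norm (b n - \<i> * of_real rho * a n) > rho * norm A / 2"
    using rho_pos A0 by (intro order_tendstoD(1)) auto
  then have "\<forall>\<^sub>F n in sequentially. rho * norm A * rho ^ Suc n / sqrt (Suc n) \<le> norm (cheb_coeff (Suc n) (Suc n + 1)) + norm (cheb_coeff (Suc n) (Suc n + 2))"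
  proof eventually_elim
    case (elim n)
    \<comment> \<open>The phase of the \<open>m\<close>-th power at the saddle point.\<close>
    define Z where "Z = ?S0 ^ Suc n / of_real (rho ^ Suc n)"
    have Z1: "norm Z = 1"
      unfolding Z_def norm_divide norm_power norm_saddle_fun_pt norm_of_real using rho_pos by simp
    have S0: "?S0 \<noteq> 0" using norm_saddle_fun_pt rho_pos by auto
    define \<kappa> where "\<kappa> = rho ^ Suc n / sqrt (Suc n)"
    have \<kappa>: "\<kappa> > 0" using rho_pos by (simp add: \<kappa>_def)
    have ch: "norm (cheb_coeff (Suc n) (Suc n + j)) = 2 * \<kappa> * \<bar>Re (Z * t)\<bar>"
      if "t = of_real (sqrt (Suc n)) * saddle_half (Suc n) (Suc n + j) / ?S0 ^ Suc n" "j \<ge> 1" for t j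
    proof -
      have "saddle_half (Suc n) (Suc n + j) = of_real \<kappa> * (Z * t)"
        unfolding that(1) \<kappa>_def Z_def using S0 rho_pos by (simp del: power_Suc add_Suc)
      then have "cheb_coeff (Suc n) (Suc n + j) = of_real (2 * Re (of_real \<kappa> * (Z * t)))"
        using cheb_coeff_eq_half[of "Suc n" "Suc n + j"] that(2) by simp
      then have "norm (cheb_coeff (Suc n) (Suc n + j)) = \<bar>2 * Re (of_real \<kappa> * (Z * t))\<bar>"
        by (simp only: norm_of_real)
      also have "\<dots> = 2 * \<kappa> * \<bar>Re (Z * t)\<bar>"
      proof -
        have "Re (of_real \<kappa> * w) = \<kappa> * Re w" for w by simp
        then show ?thesis using \<kappa> by (simp only: abs_mult abs_of_pos)
      qed
      finally show ?thesis .
    qed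
    define e where "e = b n - \<i> * of_real rho * a n"
    have bn: "Z * b n = \<i> * of_real rho * (Z * a n) + Z * e" by (simp add: e_def algebra_simps)
    have "Re (Z * b n) = - rho * Im (Z * a n) + Re (Z * e)" unfolding bn by simp
    moreover have "\<bar>Re (Z * e)\<bar> \<le> norm e"
      using abs_Re_le_cmod[of "Z * e"] Z1 by (simp add: norm_mult)
    moreover have "\<bar>- rho * Im (Z * a n)\<bar> = rho * \<bar>Im (Z * a n)\<bar>" using rho_pos by (simp add: abs_mult)
    ultimately have 1: "\<bar>Re (Z * b n)\<bar> \<ge> rho * \<bar>Im (Z * a n)\<bar> - norm e" by linarith
    have "norm (a n) = norm (Z * a n)" by (simp add: norm_mult Z1)
    also have "\<dots> \<le> \<bar>Re (Z * a n)\<bar> + \<bar>Im (Z * a n)\<bar>" by (rule cmod_le)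
    finally have "rho * norm (a n) \<le> rho * (\<bar>Re (Z * a n)\<bar> + \<bar>Im (Z * a n)\<bar>)"
      using rho_pos by (intro mult_left_mono) auto
    moreover have "rho * \<bar>Re (Z * a n)\<bar> \<le> 1 * \<bar>Re (Z * a n)\<bar>"
      using real_sqrt_less_mono[of 2 4] by (intro mult_right_mono) (auto simp: rho_def)
    ultimately have "rho * norm (a n) - norm e \<le> \<bar>Re (Z * a n)\<bar> + \<bar>Re (Z * b n)\<bar>"
      using 1 by (simp add: distrib_left)
    then have "rho * norm A / 2 \<le> \<bar>Re (Z * a n)\<bar> + \<bar>Re (Z * b n)\<bar>"
      using elim by (simp add: e_def)
    then have "2 * \<kappa> * (rho * norm A / 2) \<le> 2 * \<kappa> * (\<bar>Re (Z * a n)\<bar> + \<bar>Re (Z * b n)\<bar>)"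
      using \<kappa> by (intro mult_left_mono) auto
    also have "\<dots> = norm (cheb_coeff (Suc n) (Suc n + 1)) + norm (cheb_coeff (Suc n) (Suc n + 2))"
      using ch[of "a n" 1] ch[of "b n" 2] by (simp add: a_def b_def distrib_left del: power_Suc add_Suc)
    finally show ?case by (simp add: \<kappa>_def mult_ac)
  qed
  then have "\<forall>\<^sub>F m in sequentially. rho * norm A * rho ^ m / sqrt m \<le> norm (cheb_coeff m (m + 1)) + norm (cheb_coeff m (m + 2))"
    by (subst (asm) eventually_sequentially_Suc)
  moreover have "rho * norm A > 0" using rho_pos A0 by simp
  ultimately show ?thesis by blast
qed

section \<open>Two-sided bounds for the rational error\<close>

lemma rat_error_le:
  assumes q: "q > 0" and t: "t > 0" and deg: "degree P \<le> m"
    and B: "\<And>z. z \<le> 0 \<Longrightarrow> \<bar>exp (t * z) - poly P z / (q - z) ^ m\<bar> \<le> B"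
  shows "rat_error m t q \<le> B"
  unfolding rat_error_def
proof (rule cINF_lower2)
  show "(\<lambda>z. poly P z / (q - z) ^ m) \<in> restricted_rat m q"
    using deg by (auto simp: restricted_rat_def)
  show "(SUP z\<in>{..0}. \<bar>exp (t * z) - poly P z / (q - z) ^ m\<bar>) \<le> B"
    by (rule cSUP_least) (auto intro: B)
  show "bdd_below ((\<lambda>r. SUP z\<in>{..0}. \<bar>exp (t * z) - r z\<bar>) ` restricted_rat m q)"
  proof (rule bdd_belowI2[of _ 0])
    fix r assume "r \<in> restricted_rat m q"
    then have "\<bar>exp (t * 0) - r 0\<bar> \<le> (SUP z\<in>{..0}. \<bar>exp (t * z) - r z\<bar>)"
      using bdd_above_rat_error[OF q t] by (intro cSUP_upper2) auto
    then show "0 \<le> (SUP z\<in>{..0}. \<bar>exp (t * z) - r z\<bar>)" by linarith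
  qed
qed

lemma le_rat_error:
  assumes q: "q > 0" and t: "t > 0"
    and b: "\<And>P B. degree P \<le> m \<Longrightarrow> (\<And>z. z \<le> 0 \<Longrightarrow> \<bar>exp (t * z) - poly P z / (q - z) ^ m\<bar> \<le> B) \<Longrightarrow> b \<le> B"
  shows "b \<le> rat_error m t q"
  unfolding rat_error_def
proof (rule cINF_greatest)
  show "restricted_rat m q \<noteq> {}" unfolding restricted_rat_def by (auto intro: exI[of _ 0])
  fix r assume r: "r \<in> restricted_rat m q"
  then obtain P where P: "degree P \<le> m" "r = (\<lambda>z. poly P z / (q - z) ^ m)"
    by (auto simp: restricted_rat_def)
  show "b \<le> (SUP z\<in>{..0}. \<bar>exp (t * z) - r z\<bar>)"
  proof (rule b[OF P(1)])
    fix z :: real assume "z \<le> 0"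
    then show "\<bar>exp (t * z) - poly P z / (q - z) ^ m\<bar> \<le> (SUP z\<in>{..0}. \<bar>exp (t * z) - r z\<bar>)"
      using bdd_above_rat_error[OF q t r] unfolding P(2) by (intro cSUP_upper) auto
  qed
qed

lemma opt_pole_pos: "m > 0 \<Longrightarrow> t > 0 \<Longrightarrow> opt_pole m t > 0"
  by (simp add: opt_pole_def)

lemma t_opt_pole: "t > 0 \<Longrightarrow> t * opt_pole m t = real m / sqrt 2"
  by (simp add: opt_pole_def)

text \<open>The substitution \<open>s = q / (q - z)\<close> maps the half-line \<open>z \<le> 0\<close> to \<open>0 < s \<le> 1\<close>; this lemma and the next
one say that it identifies the admissible rational functions with polynomials in \<open>s\<close>.\<close>

lemma restricted_rat_of_poly:
  fixes Q :: "real poly"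
  assumes q: "q > 0" and deg: "degree Q \<le> m"
  shows "\<exists>P. degree P \<le> m \<and> (\<forall>z\<le>0. poly P z / (q - z) ^ m = poly Q (q / (q - z)))"
proof -
  define P where "P = (\<Sum>i\<le>m. smult (coeff Q i * q ^ i) ([:q, -1:] ^ (m - i)))"
  have "degree ([:q, -1:] ^ (m - i)) \<le> m" for i
    by (rule order_trans[OF degree_power_le]) auto
  then have "degree P \<le> m"
    unfolding P_def by (intro degree_sum_le order_trans[OF degree_smult_le]) auto
  moreover have "poly P z / (q - z) ^ m = poly Q (q / (q - z))" if z: "z \<le> 0" for z
  proof -
    have qz: "q - z > 0" using q z by simp
    have Q: "poly Q x = (\<Sum>i\<le>m. coeff Q i * x ^ i)" for x
      unfolding poly_altdef using deg by (intro sum.mono_neutral_left) (auto simp: coeff_eq_0)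
    have "coeff Q i * q ^ i * (q - z) ^ (m - i) / (q - z) ^ m = coeff Q i * (q / (q - z)) ^ i" if "i \<le> m" for i
    proof -
      have "(q - z) ^ m = (q - z) ^ i * (q - z) ^ (m - i)" using that by (simp flip: power_add)
      then show ?thesis using qz by (simp add: power_divide)
    qed
    then show ?thesis
      unfolding P_def Q poly_sum sum_divide_distrib by (intro sum.cong) (auto simp: poly_power)
  qed
  ultimately show ?thesis by blast
qed

lemma poly_of_restricted_rat:
  fixes P :: "real poly"
  assumes q: "q > 0" and deg: "degree P \<le> m"
  shows "\<exists>Q. degree Q \<le> m \<and> (\<forall>s>0. poly P (q - q / s) / (q - (q - q / s)) ^ m = poly Q s)"
proof -
  define Q where "Q = (\<Sum>i\<le>m. smult (coeff P i / q ^ m) ([:-q, q:] ^ i * [:0, 1:] ^ (m - i)))"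
  have "degree ([:-q, q:] ^ i * [:0, 1:] ^ (m - i)) \<le> m" if "i \<le> m" for i
  proof -
    have "degree ([:-q, q:] ^ i * [:0, 1:] ^ (m - i)) \<le> degree ([:-q, q:] ^ i) + degree ([:0, 1:] ^ (m - i) :: real poly)"
      by (rule degree_mult_le)
    also have "\<dots> \<le> 1 * i + 1 * (m - i)"
      by (intro add_mono order_trans[OF degree_power_le]) auto
    finally show ?thesis using that by simp
  qed
  then have "degree Q \<le> m"
    unfolding Q_def by (intro degree_sum_le order_trans[OF degree_smult_le]) auto
  moreover have "poly P (q - q / s) / (q - (q - q / s)) ^ m = poly Q s" if s: "s > 0" for s
  proof -
    have P: "poly P x = (\<Sum>i\<le>m. coeff P i * x ^ i)" for x
      unfolding poly_altdef using deg by (intro sum.mono_neutral_left) (auto simp: coeff_eq_0)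
    have "coeff P i * (q - q / s) ^ i / (q / s) ^ m = coeff P i / q ^ m * ((q * s - q) ^ i * s ^ (m - i))" if "i \<le> m" for i
    proof -
      have "q - q / s = (q * s - q) / s" using s by (simp add: field_simps)
      moreover have "s ^ m = s ^ i * s ^ (m - i)" using that by (simp flip: power_add)
      ultimately show ?thesis using s q by (simp add: power_divide)
    qed
    then show ?thesis
      unfolding Q_def P poly_sum sum_divide_distrib
      by (intro sum.cong) (auto simp: poly_power algebra_simps)
  qed
  ultimately show ?thesis by blast
qed

lemma rat_error_upper:
  assumes m: "m > 0" and t: "t > 0"
  shows "rat_error m t (opt_pole m t) \<le> upper_const * rho ^ m / sqrt m"
proof -
  let ?q = "opt_pole m t"
  have q: "?q > 0" by (rule opt_pole_pos[OF m t])
  obtain Q where Q: "degree Q \<le> m" "\<And>\<tau>. \<bar>exp (- (real m / sqrt 2) * \<tau>\<^sup>2) - poly Q (1 / (1 + \<tau>\<^sup>2))\<bar>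
             \<le> upper_const * rho ^ m / sqrt m"
    using gauss_approx_poly[OF m] by blast
  obtain P where P: "degree P \<le> m" "\<And>z. z \<le> 0 \<Longrightarrow> poly P z / (?q - z) ^ m = poly Q (?q / (?q - z))"
    using restricted_rat_of_poly[OF q Q(1)] by blast
  show ?thesis
  proof (rule rat_error_le[OF q t P(1)])
    fix z :: real assume z: "z \<le> 0"
    define \<tau> where "\<tau> = sqrt (- z / ?q)"
    have \<tau>: "\<tau>\<^sup>2 = - z / ?q" using z q by (simp add: \<tau>_def divide_nonpos_pos)
    have "1 / (1 + \<tau>\<^sup>2) = ?q / (?q - z)" unfolding \<tau> using q z by (simp add: field_simps)
    moreover have "- (real m / sqrt 2) * \<tau>\<^sup>2 = t * z"
      unfolding \<tau> t_opt_pole[OF t, of m, symmetric] using q by simp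
    ultimately show "\<bar>exp (t * z) - poly P z / (?q - z) ^ m\<bar> \<le> upper_const * rho ^ m / sqrt m"
      using Q(2)[of \<tau>] P(2)[OF z] by simp
  qed
qed

lemma rat_error_ge_cheb_coeff:
  assumes m: "m > 0" and t: "t > 0" and k: "m < k"
  shows "norm (cheb_coeff m k) / (2 * pi) \<le> rat_error m t (opt_pole m t)"
proof (rule le_rat_error[OF opt_pole_pos[OF m t] t])
  let ?q = "opt_pole m t"
  fix P B assume P: "degree P \<le> m" and B: "\<And>z. z \<le> 0 \<Longrightarrow> \<bar>exp (t * z) - poly P z / (?q - z) ^ m\<bar> \<le> B"
  have q: "?q > 0" by (rule opt_pole_pos[OF m t])
  have "norm (cheb_coeff m k) \<le> 2 * pi * B"
  proof (rule cheb_coeff_le_error[OF m P k q])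
    fix \<tau>
    have "- (real m / sqrt 2) * \<tau>\<^sup>2 = t * (- ?q * \<tau>\<^sup>2)"
      unfolding t_opt_pole[OF t, of m, symmetric] by simp
    then show "\<bar>exp (- (real m / sqrt 2) * \<tau>\<^sup>2) - poly P (- ?q * \<tau>\<^sup>2) / (?q - (- ?q * \<tau>\<^sup>2)) ^ m\<bar> \<le> B"
      using B[of "- ?q * \<tau>\<^sup>2"] q by (simp only:) simp
  qed
  then show "norm (cheb_coeff m k) / (2 * pi) \<le> B" by (simp add: divide_le_eq mult.commute)
qed

text \<open>Induction on the degree: the first difference \<open>p (x + d) - p x\<close> has smaller degree and is bounded by
\<open>2 * B\<close>.\<close>

lemma poly_extrapolation_bound:
  fixes p :: "real poly"
  assumes "degree p \<le> n" "\<And>j. j \<le> n \<Longrightarrow> \<bar>poly p (x + real j * d)\<bar> \<le> B"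
  shows "\<bar>poly p (x + real (Suc n) * d)\<bar> \<le> 3 ^ Suc n * B"
  using assms
proof (induction n arbitrary: p B)
  case 0
  then obtain c where "p = [:c:]" by (auto elim: degree_eq_zeroE)
  then show ?case using 0(2)[of 0] by simp
next
  case (Suc n)
  define r where "r = p \<circ>\<^sub>p [:d, 1:] - p"
  have r: "poly r y = poly p (y + d) - poly p y" for y
    by (simp add: r_def poly_pcompose add.commute)
  have "degree r \<le> n"
  proof -
    have dp: "degree (p \<circ>\<^sub>p [:d, 1:]) = degree p" by (simp add: degree_pcompose)
    have "coeff (p \<circ>\<^sub>p [:d, 1:]) (degree p) = coeff p (degree p)"
      using lead_coeff_comp[of "[:d, 1:]" p] dp by simp
    then have "coeff r i = 0" if "i > n" for i
      using that Suc.prems(1) dp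
      by (cases "i = degree p") (auto simp: r_def coeff_eq_0)
    then show ?thesis by (intro degree_le) auto
  qed
  moreover have "\<bar>poly r (x + real j * d)\<bar> \<le> 2 * B" if "j \<le> n" for j
    using Suc.prems(2)[of j] Suc.prems(2)[of "Suc j"] that
    by (simp add: r distrib_right add_ac)
  ultimately have "\<bar>poly r (x + real (Suc n) * d)\<bar> \<le> 3 ^ Suc n * (2 * B)"
    by (rule Suc.IH)
  moreover have "\<bar>poly p (x + real (Suc n) * d)\<bar> \<le> B" by (rule Suc.prems(2)) simp
  moreover have "poly p (x + real (Suc (Suc n)) * d) = poly p (x + real (Suc n) * d) + poly r (x + real (Suc n) * d)"
    by (simp add: r algebra_simps)
  ultimately have "\<bar>poly p (x + real (Suc (Suc n)) * d)\<bar> \<le> B + 3 ^ Suc n * (2 * B)" by linarith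
  also have "\<dots> \<le> 3 ^ Suc n * B + 3 ^ Suc n * (2 * B)"
  proof -
    have "0 \<le> B" using Suc.prems(2)[of 0] abs_ge_zero order_trans by blast
    then have "1 * B \<le> 3 ^ Suc n * B" by (intro mult_right_mono one_le_power) auto
    then show ?thesis by (intro add_right_mono) (simp only: mult_1)
  qed
  also have "\<dots> = 3 ^ Suc (Suc n) * B" by simp
  finally show ?case .
qed

text \<open>In the variable \<open>s\<close> the exponential is \<open>f s = exp (a - a / s)\<close>, which varies so fast near \<open>s = 0\<close> that
no polynomial of degree \<open>m\<close> can follow it. At equally spaced points \<open>d, 2 d, \<dots>, (m + 2) d\<close> a good
approximant is almost 0 at the first \<open>m + 1\<close> points, relative to the value of \<open>f\<close> at the last one,
and therefore also too small at the last one by \<open>poly_extrapolation_bound\<close>.\<close>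

lemma rat_error_bounded_below:
  assumes m: "m > 0"
  shows "\<exists>b>0. \<forall>t>0. b \<le> rat_error m t (opt_pole m t)"
proof -
  define a where "a = real m / sqrt 2"
  have a: "a > 0" using m by (simp add: a_def)
  \<comment> \<open>The spacing \<open>d\<close> is chosen so that \<open>f s2 / f s1 = exp M\<close> exceeds the extrapolation factor
    \<open>3 ^ (m + 1)\<close>; the summand \<open>a\<close> in \<open>M\<close> makes \<open>d\<close> small enough to keep all points in \<open>{0<..1}\<close>.\<close>
  define M where "M = (real m + 1) * ln 3 + a + 1"
  have M: "M > (real m + 1) * ln 3" "M > 0" "M \<ge> a"
    using a by (auto simp: M_def intro!: add_nonneg_pos mult_nonneg_nonneg)
  define d where "d = a / ((real m + 1) * (real m + 2) * M)"
  have d: "d > 0" using a M by (simp add: d_def)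
  define f where "f s = exp (a - a / s)" for s
  define s1 where "s1 = d * (real m + 1)"
  define s2 where "s2 = d * (real m + 2)"
  have s: "0 < s1" "s1 < s2" using d by (auto simp: s1_def s2_def)
  have s2_le: "s2 \<le> 1"
  proof -
    have "s2 = a / ((real m + 1) * M)" using M by (simp add: s2_def d_def)
    also have "a \<le> (real m + 1) * M" using mult_mono[of 1 "real m + 1" a M] M a by simp
    then have "a / ((real m + 1) * M) \<le> 1" using M by (simp add: divide_le_eq)
    finally show ?thesis .
  qed
  have f_mono: "f x \<le> f y" if "0 < x" "x \<le> y" for x y
    using that a by (simp add: f_def divide_left_mono)
  define \<beta> where "\<beta> = f s2 - 3 ^ (m + 1) * f s1"
  have "a / s1 - a / s2 = M"
  proof -
    have "a / s1 - a / s2 = a / (d * ((real m + 1) * (real m + 2)))"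
    proof -
      have "a / (d * n) - a / (d * k) = a * (k - n) / (d * (n * k))" if "n > 0" "k > 0" for n k
        using that d by (simp add: field_simps)
      from this[of "real m + 1" "real m + 2"] show ?thesis by (simp add: s1_def s2_def)
    qed
    also have "d * ((real m + 1) * (real m + 2)) = a / M" using M by (simp add: d_def)
    finally show ?thesis using a M by simp
  qed
  then have "f s2 = exp M * f s1" by (simp add: f_def flip: exp_add)
  moreover have "exp M > 3 ^ (m + 1)"
  proof -
    have "(3::real) ^ (m + 1) = exp ((real m + 1) * ln 3)"
      using exp_of_nat_mult[of "m + 1" "ln (3::real)"] by (simp add: add.commute)
    then show ?thesis using M(1) by simp
  qed
  ultimately have \<beta>: "\<beta> > 0" by (simp add: \<beta>_def f_def)
  define b where "b = \<beta> / (1 + 3 ^ (m + 1))"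
  have "b \<le> rat_error m t (opt_pole m t)" if t: "t > 0" for t
  proof (rule le_rat_error[OF opt_pole_pos[OF m t] t])
    let ?q = "opt_pole m t"
    have q: "?q > 0" by (rule opt_pole_pos[OF m t])
    fix P B assume P: "degree P \<le> m" and B: "\<And>z. z \<le> 0 \<Longrightarrow> \<bar>exp (t * z) - poly P z / (?q - z) ^ m\<bar> \<le> B"
    obtain Q where Q: "degree Q \<le> m" "\<And>s. s > 0 \<Longrightarrow> poly P (?q - ?q / s) / (?q - (?q - ?q / s)) ^ m = poly Q s"
      using poly_of_restricted_rat[OF q P] by blast
    have fQ: "\<bar>f s - poly Q s\<bar> \<le> B" if s: "0 < s" "s \<le> 1" for s
    proof -
      have "?q - ?q / s \<le> 0" using s q by (simp add: field_simps)
      moreover have "t * (?q - ?q / s) = a - a / s"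
        unfolding a_def t_opt_pole[OF t, of m, symmetric] by (simp add: right_diff_distrib)
      ultimately show ?thesis using B[of "?q - ?q / s"] Q(2)[OF s(1)] by (simp add: f_def)
    qed
    have "\<bar>poly Q (d + real j * d)\<bar> \<le> f s1 + B" if "j \<le> m" for j
    proof -
      have 1: "0 < d + real j * d" "d + real j * d \<le> s1"
        using d that mult_right_mono[of "real j" "real m" d] by (auto simp: s1_def algebra_simps intro: add_pos_nonneg)
      have "f (d + real j * d) > 0" by (simp add: f_def)
      then show ?thesis using fQ[of "d + real j * d"] f_mono[OF 1] 1 s s2_le by linarith
    qed
    then have "\<bar>poly Q (d + real (Suc m) * d)\<bar> \<le> 3 ^ Suc m * (f s1 + B)"
      by (rule poly_extrapolation_bound[OF Q(1)])
    moreover have "d + real (Suc m) * d = s2" by (simp add: s2_def algebra_simps)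
    ultimately have "\<bar>poly Q s2\<bar> \<le> 3 ^ (m + 1) * (f s1 + B)" by simp
    then have "f s2 \<le> B + 3 ^ (m + 1) * (f s1 + B)"
      using fQ[of s2] s s2_le by linarith
    then have "\<beta> \<le> B * (1 + 3 ^ (m + 1))" by (simp add: \<beta>_def algebra_simps)
    then show "b \<le> B" by (simp add: b_def divide_le_eq add_pos_pos)
  qed
  moreover have "b > 0" using \<beta> by (simp add: b_def add_pos_pos)
  ultimately show ?thesis by blast
qed

lemma rat_error_two_sided:
  "\<exists>c1>0. \<exists>c2>0. \<forall>m>0. \<forall>t>0. c1 * rho ^ m / sqrt m \<le> rat_error m t (opt_pole m t)
      \<and> rat_error m t (opt_pole m t) \<le> c2 * rho ^ m / sqrt m"
proof -
  let ?w = "\<lambda>m::nat. rho ^ m / sqrt m"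
  obtain c N where c: "c > 0" "\<And>m. m \<ge> N \<Longrightarrow> c * rho ^ m / sqrt m \<le> norm (cheb_coeff m (m + 1)) + norm (cheb_coeff m (m + 2))"
    using cheb_coeff_lower unfolding eventually_sequentially by blast
  have big: "c / (4 * pi) * ?w m \<le> rat_error m t (opt_pole m t)" if "m \<ge> N" "m > 0" "t > 0" for m t
  proof -
    let ?E = "rat_error m t (opt_pole m t)"
    have "norm (cheb_coeff m k) \<le> 2 * pi * ?E" if "m < k" for k
      using rat_error_ge_cheb_coeff[OF \<open>m > 0\<close> \<open>t > 0\<close> that] by (simp add: divide_le_eq mult.commute)
    then have "c * rho ^ m / sqrt m \<le> 2 * pi * ?E + 2 * pi * ?E"
      using c(2)[OF that(1)] by (meson add_mono less_add_same_cancel1 order_trans zero_less_numeral zero_less_one)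
    moreover have "W / (4 * pi) \<le> E" if "W \<le> 2 * pi * E + 2 * pi * E" for W E :: real
      using that by (simp add: divide_le_eq algebra_simps)
    ultimately have "c * rho ^ m / sqrt m / (4 * pi) \<le> ?E" by blast
    then show ?thesis by (simp add: mult_ac)
  qed
  have "\<exists>b. \<forall>m>0. b m > 0 \<and> (\<forall>t>0. b m \<le> rat_error m t (opt_pole m t))"
    using rat_error_bounded_below by metis
  then obtain b where b: "\<And>m. m > 0 \<Longrightarrow> b m > 0" "\<And>m t. m > 0 \<Longrightarrow> t > 0 \<Longrightarrow> b m \<le> rat_error m t (opt_pole m t)"
    by blast
  \<comment> \<open>The asymptotic bound serves from \<open>N\<close> on; finitely many degrees remain.\<close>
  define S where "S = insert (c / (4 * pi)) ((\<lambda>m. b m / ?w m) ` {0<..<N})"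
  define c1 where "c1 = Min S"
  have S: "finite S" "S \<noteq> {}" by (auto simp: S_def)
  have w: "?w m > 0" if "m > 0" for m using that rho_pos by simp
  have "b m / ?w m > 0" if "m > 0" for m by (rule divide_pos_pos[OF b(1) w]) (rule that)+
  then have "\<forall>x\<in>S. x > 0" using c(1) unfolding S_def by auto
  then have "c1 > 0" unfolding c1_def using S by (subst Min_gr_iff) auto
  moreover have "c1 * rho ^ m / sqrt m \<le> rat_error m t (opt_pole m t)" if m: "m > 0" and t: "t > 0" for m t
  proof (cases "m \<ge> N")
    case True
    have "c1 \<le> c / (4 * pi)" unfolding c1_def using S by (intro Min_le) (auto simp: S_def)
    then have "c1 * ?w m \<le> c / (4 * pi) * ?w m" using w[OF m] by (intro mult_right_mono) auto
    also have "\<dots> \<le> rat_error m t (opt_pole m t)" by (rule big[OF True m t])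
    finally show ?thesis by simp
  next
    case False
    then have "c1 \<le> b m / ?w m" unfolding c1_def using S m by (intro Min_le) (auto simp: S_def)
    then have "c1 * ?w m \<le> b m" using w[OF m] by (subst (asm) pos_le_divide_eq) auto
    also have "\<dots> \<le> rat_error m t (opt_pole m t)" by (rule b(2)[OF m t])
    finally show ?thesis by simp
  qed
  moreover have "upper_const > 0" using rho_pos saddle_im by (simp add: upper_const_def)
  ultimately show ?thesis using rat_error_upper by blast
qed

section \<open>The first sufficient degree\<close>

lemma square_Zsqrt2: "(a + b * sqrt 2)\<^sup>2 = (a * a + 2 * (b * b)) + (2 * a * b) * sqrt 2" for a b :: real
  by (simp add: power2_eq_square algebra_simps)

text \<open>The fraction \<open>209 / 80\<close> is so close to \<open>ln 10 / arsinh 1\<close> that both bounds follow from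
\<open>10 ^ 80 < (1 + sqrt 2) ^ 209 < 1.001 * 10 ^ 80\<close>, where the power is computed exactly by repeated
squaring.\<close>

lemma ln_10_over_arsinh_1: "\<bar>ln 10 / arsinh 1 - 2.6125 :: real\<bar> < 0.00005"
proof -
  define x where "x = 1 + sqrt (2::real)"
  have step: "x ^ Suc k = (a + 2 * b) + (a + b) * sqrt 2" if "x ^ k = a + b * sqrt 2" for a b k
    using that by (simp add: x_def algebra_simps)
  have p1: "x ^ 1 = 1 + 1 * sqrt 2" by (simp add: x_def)
  have p2: "x ^ 2 = 3 + 2 * sqrt 2"
    using power_mult[of x 1 2] unfolding p1 square_Zsqrt2 by simp
  have p3: "x ^ 3 = 7 + 5 * sqrt 2"
    using step[OF p2] by simp
  have p6: "x ^ 6 = 99 + 70 * sqrt 2"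
    using power_mult[of x 3 2] unfolding p3 square_Zsqrt2 by simp
  have p12: "x ^ 12 = 19601 + 13860 * sqrt 2"
    using power_mult[of x 6 2] unfolding p6 square_Zsqrt2 by simp
  have p13: "x ^ 13 = 47321 + 33461 * sqrt 2"
    using step[OF p12] by simp
  have p26: "x ^ 26 = 4478554083 + 3166815962 * sqrt 2"
    using power_mult[of x 13 2] unfolding p13 square_Zsqrt2 by simp
  have p52: "x ^ 52 = 40114893348711941777 + 28365513113449345692 * sqrt 2"
    using power_mult[of x 26 2] unfolding p26 square_Zsqrt2 by simp
  have p104: "x ^ 104 = 3218409336757067172026376119771675835457 + 2275759066655021041292938373174899549368 * sqrt 2"
    using power_mult[of x 52 2] unfolding p52 square_Zsqrt2 by simp
  have p208: "x ^ 208 = 20716317317850130010861529174402491934418529547397092848268720195588517876797697 + 14648648456664136982759072688288917588580936663412552040434663580265208432682352 * sqrt 2"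
    using power_mult[of x 104 2] unfolding p104 square_Zsqrt2 by simp
  have p209: "x ^ 209 = 50013614231178403976379674550980327111580402874222196929138047356118934742162401 + 35364965774514266993620601862691409522999466210809644888703383775853726309480049 * sqrt 2"
    using step[OF p208] by simp
  have s: "7071 / 5000 < sqrt 2" "sqrt 2 < (14143 / 10000 :: real)"
    using real_less_rsqrt[of "7071 / 5000" 2] real_less_lsqrt[of "14143 / 10000" 2]
    by (simp_all add: power2_eq_square)
  have lo: "10 ^ 80 < x ^ 209" and hi: "x ^ 209 < 10 ^ 80 * 1.001"
    unfolding p209 using s by simp_all
  have x: "x > 1" by (simp add: x_def)
  define \<alpha> where "\<alpha> = ln x"
  have \<alpha>: "\<alpha> > 1/2"
  proof -
    have "exp (1/2 :: real) \<le> 1 + 1/2 + (1/2)\<^sup>2" by (rule exp_bound) auto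
    also have "\<dots> < x" using s by (simp add: x_def power2_eq_square)
    finally have "ln (exp (1/2)) < ln x" using x by (subst ln_less_cancel_iff) auto
    then show ?thesis by (simp add: \<alpha>_def)
  qed
  have ln10: "ln ((10 :: real) ^ 80) = 80 * ln 10" by (subst ln_realpow) simp_all
  have lnx: "ln (x ^ 209) = 209 * \<alpha>" using x by (subst ln_realpow) (simp_all add: \<alpha>_def)
  have "ln ((10 :: real) ^ 80) < ln (x ^ 209)" using lo x by (subst ln_less_cancel_iff) auto
  then have 1: "80 * ln 10 < 209 * \<alpha>" unfolding ln10 lnx .
  have "ln (x ^ 209) < ln (10 ^ 80 * 1.001)" using hi x by (subst ln_less_cancel_iff) auto
  also have "\<dots> = ln (10 ^ 80) + ln 1.001" by (rule ln_mult_pos) simp_all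
  also have "ln 1.001 \<le> (0.001 :: real)" using ln_le_minus_one[of "1.001"] by simp
  finally have 2: "209 * \<alpha> < 80 * ln 10 + 0.001" unfolding ln10 lnx by simp
  have "arsinh 1 = \<alpha>" by (simp add: \<alpha>_def x_def arsinh_real_def add.commute)
  moreover have "ln 10 / \<alpha> < 209 / 80" using 1 \<alpha> by (simp add: divide_less_eq)
  moreover have "2.61246 < ln 10 / \<alpha>" using 2 \<alpha> by (simp add: less_divide_eq)
  ultimately show ?thesis by (simp add: abs_less_iff)
qed

text \<open>Minus the logarithm of \<open>rho ^ m / sqrt m\<close>.\<close>

definition decay_exponent :: "nat \<Rightarrow> real" where
  "decay_exponent m = arsinh 1 * real m + ln (real m) / 2"

lemma arsinh_1_pos: "arsinh (1::real) > 0"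
  by simp

lemma rho_power_over_sqrt:
  assumes "m > 0"
  shows "rho ^ m / sqrt m = exp (- decay_exponent m)"
proof -
  have "sqrt m = exp (ln (real m) / 2)"
    using assms by (simp add: ln_sqrt[symmetric])
  then show ?thesis
    by (simp add: decay_exponent_def rho_eq_exp exp_diff exp_minus exp_of_nat_mult[symmetric] mult.commute field_simps flip: exp_add)
qed

lemma rat_error_exp_bounds:
  "\<exists>K\<ge>0. \<forall>m>0. \<forall>t>0. exp (- decay_exponent m - K) \<le> rat_error m t (opt_pole m t)
     \<and> rat_error m t (opt_pole m t) \<le> exp (- decay_exponent m + K)"
proof -
  obtain c1 c2 where c: "c1 > 0" "c2 > 0"
    "\<And>m t. m > 0 \<Longrightarrow> t > 0 \<Longrightarrow> c1 * rho ^ m / sqrt m \<le> rat_error m t (opt_pole m t)"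
    "\<And>m t. m > 0 \<Longrightarrow> t > 0 \<Longrightarrow> rat_error m t (opt_pole m t) \<le> c2 * rho ^ m / sqrt m"
    using rat_error_two_sided by blast
  define K where "K = max 0 (max (- ln c1) (ln c2))"
  have "exp (- K) \<le> exp (ln c1)" "exp (ln c2) \<le> exp K" by (auto simp: K_def)
  then have K: "exp (- K) \<le> c1" "c2 \<le> exp K" using c(1,2) by simp_all
  show ?thesis
  proof (intro exI[of _ K] conjI allI impI)
    show "K \<ge> 0" by (simp add: K_def)
    fix m :: nat and t :: real assume m: "m > 0" and t: "t > 0"
    have "exp (- decay_exponent m - K) = exp (- K) * (rho ^ m / sqrt m)"
      unfolding rho_power_over_sqrt[OF m] by (simp flip: exp_add)
    also have "\<dots> \<le> c1 * (rho ^ m / sqrt m)" using K rho_pos by (intro mult_right_mono) auto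
    finally show "exp (- decay_exponent m - K) \<le> rat_error m t (opt_pole m t)" using c(3)[OF m t] by simp
    have "c2 * (rho ^ m / sqrt m) \<le> exp K * (rho ^ m / sqrt m)" using K rho_pos by (intro mult_right_mono) auto
    also have "\<dots> = exp (- decay_exponent m + K)"
      unfolding rho_power_over_sqrt[OF m] by (simp flip: exp_add)
    finally show "rat_error m t (opt_pole m t) \<le> exp (- decay_exponent m + K)" using c(4)[OF m t] by simp
  qed
qed

lemma exists_degree:
  assumes t: "t > 0" and \<epsilon>: "\<epsilon> > 0"
  shows "\<exists>m\<ge>1. rat_error m t (opt_pole m t) \<le> \<epsilon>"
proof -
  obtain K where K: "\<And>m t. m > 0 \<Longrightarrow> t > 0 \<Longrightarrow> rat_error m t (opt_pole m t) \<le> exp (- decay_exponent m + K)"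
    using rat_error_exp_bounds by blast
  obtain n where n: "(K - ln \<epsilon>) / arsinh 1 \<le> real n" using real_arch_simple by blast
  define m where "m = Suc n"
  have "K - ln \<epsilon> \<le> arsinh 1 * real n" using n arsinh_1_pos by (simp add: divide_le_eq mult.commute)
  also have "\<dots> \<le> arsinh 1 * real m"
    using arsinh_1_pos by (intro mult_left_mono) (auto simp: m_def less_imp_le)
  also have "\<dots> \<le> decay_exponent m" by (simp add: decay_exponent_def m_def)
  finally have "exp (- decay_exponent m + K) \<le> exp (ln \<epsilon>)" by simp
  then have "rat_error m t (opt_pole m t) \<le> \<epsilon>" using K[of m t] t \<epsilon> by (simp add: m_def)
  then show ?thesis by (intro exI[of _ m]) (auto simp: m_def)
qed

lemma first_degree_props:
  assumes t: "t > 0" and \<epsilon>: "\<epsilon> > 0"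
  shows "first_degree t \<epsilon> \<ge> 1"
    and "rat_error (first_degree t \<epsilon>) t (opt_pole (first_degree t \<epsilon>) t) \<le> \<epsilon>"
    and "\<And>m. 1 \<le> m \<Longrightarrow> m < first_degree t \<epsilon> \<Longrightarrow> \<epsilon> < rat_error m t (opt_pole m t)"
proof -
  let ?P = "\<lambda>m. m \<ge> 1 \<and> rat_error m t (opt_pole m t) \<le> \<epsilon>"
  have "?P (first_degree t \<epsilon>)"
    unfolding first_degree_def using exists_degree[OF t \<epsilon>] by (rule LeastI_ex)
  then show "first_degree t \<epsilon> \<ge> 1" "rat_error (first_degree t \<epsilon>) t (opt_pole (first_degree t \<epsilon>) t) \<le> \<epsilon>"
    by auto
  show "\<epsilon> < rat_error m t (opt_pole m t)" if "1 \<le> m" "m < first_degree t \<epsilon>" for m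
    using not_less_Least[of m ?P] that unfolding first_degree_def by auto
qed

lemma decay_exponent_step:
  assumes "m > 0"
  shows "decay_exponent (Suc m) \<le> decay_exponent m + arsinh 1 + 1"
proof -
  have "ln (real (Suc m)) \<le> ln (2 * real m)"
    using assms by (subst ln_le_cancel_iff) auto
  also have "\<dots> = ln 2 + ln (real m)" using assms by (simp add: ln_mult)
  also have "ln 2 \<le> (1::real)" using ln_le_minus_one[of 2] by simp
  finally show ?thesis by (simp add: decay_exponent_def algebra_simps)
qed

text \<open>By the two-sided bounds \<open>decay_exponent m = L + O(1)\<close> for the first degree \<open>m\<close>: the error at \<open>m\<close> is
at most the tolerance, that at \<open>m - 1\<close> is not, and \<open>decay_exponent\<close> has bounded increments. Since
\<open>m\<close> is then of the order of \<open>L\<close>, replacing \<open>ln m\<close> by \<open>ln L\<close> costs \<open>O(1)\<close> only.\<close>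

lemma first_degree_expansion:
  "\<exists>C e. e > 0 \<and> e < 1 \<and> (\<forall>t>0. \<forall>\<epsilon>. 0 < \<epsilon> \<and> \<epsilon> < e \<longrightarrow>
     \<bar>real (first_degree t \<epsilon>) - (log_tol \<epsilon> / arsinh 1 - ln (log_tol \<epsilon>) / (2 * arsinh 1))\<bar> \<le> C)"
proof -
  obtain K where K0: "K \<ge> 0"
    and Kl: "\<And>m t. m > 0 \<Longrightarrow> t > 0 \<Longrightarrow> exp (- decay_exponent m - K) \<le> rat_error m t (opt_pole m t)"
    and Ku: "\<And>m t. m > 0 \<Longrightarrow> t > 0 \<Longrightarrow> rat_error m t (opt_pole m t) \<le> exp (- decay_exponent m + K)"
    using rat_error_exp_bounds by blast
  define \<alpha> where "\<alpha> = arsinh (1::real)"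
  have \<alpha>: "\<alpha> > 0" unfolding \<alpha>_def by (rule arsinh_1_pos)
  define K1 where "K1 = K + \<alpha> + 1"
  define K2 where "K2 = \<bar>ln (2 / \<alpha>)\<bar> + \<bar>ln (2 * (\<alpha> + 1))\<bar>"
  have K1: "K1 \<ge> 1" using K0 \<alpha> by (simp add: K1_def)
  \<comment> \<open>Below this tolerance \<open>L > 2 * K1\<close>, so that \<open>decay_exponent m\<close> lies between \<open>L / 2\<close> and \<open>2 * L\<close>.\<close>
  define e where "e = exp (- (2 * K1))"
  have e: "e > 0" "e < 1" using K1 by (auto simp: e_def)
  have main: "\<bar>real (first_degree t \<epsilon>) - (log_tol \<epsilon> / \<alpha> - ln (log_tol \<epsilon>) / (2 * \<alpha>))\<bar> \<le> (K1 + K2 / 2) / \<alpha>"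
    if t: "t > 0" and \<epsilon>: "0 < \<epsilon>" "\<epsilon> < e" for t \<epsilon>
  proof -
    define m where "m = first_degree t \<epsilon>"
    define L where "L = log_tol \<epsilon>"
    have L_eq: "L = - ln \<epsilon>" using \<epsilon> by (simp add: L_def log_tol_def ln_div)
    have "ln \<epsilon> < ln e" using \<epsilon> by (subst ln_less_cancel_iff) auto
    then have L: "L > 2 * K1" by (simp add: L_eq e_def)
    note fd = first_degree_props[OF t \<epsilon>(1), folded m_def]
    have m: "m > 0" using fd(1) by simp
    have lower: "L - K \<le> decay_exponent m"
    proof -
      have "exp (- decay_exponent m - K) \<le> exp (- L)"
        using Kl[OF m t] fd(2) \<epsilon> by (simp add: L_eq)
      then show ?thesis by simp
    qed
    have upper: "decay_exponent m \<le> L + K1"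
    proof (cases "m = 1")
      case True
      then show ?thesis using L K1 K0 by (simp add: decay_exponent_def K1_def \<alpha>_def)
    next
      case False
      then obtain n where n: "m = Suc n" "n > 0" using m by (cases m) auto
      have "exp (- L) < exp (- decay_exponent n + K)"
        using Ku[OF n(2) t] fd(3)[of n] n \<epsilon> by (simp add: L_eq)
      then have "decay_exponent n < L + K" by simp
      then show ?thesis using decay_exponent_step[OF n(2)] unfolding n(1) by (simp add: K1_def \<alpha>_def)
    qed
    have lnm: "0 \<le> ln (real m)" "ln (real m) \<le> real m"
      using m ln_le_minus_one[of "real m"] by auto
    have dec: "decay_exponent m = \<alpha> * real m + ln (real m) / 2"
      by (simp add: decay_exponent_def \<alpha>_def)
    have K1K: "K \<le> K1" using \<alpha> by (simp add: K1_def)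
    have Lpos: "L > 0" using L K1 by simp
    have "\<alpha> * real m \<le> 2 * L" using upper dec lnm L K1 by linarith
    then have "real m \<le> L * (2 / \<alpha>)" using \<alpha> by (simp add: field_simps)
    then have "ln (real m) \<le> ln (L * (2 / \<alpha>))" using m by (subst ln_le_cancel_iff) (use Lpos \<alpha> in auto)
    then have l1: "ln (real m) \<le> ln L + ln (2 / \<alpha>)" using Lpos \<alpha> by (subst (asm) ln_mult_pos) auto
    have "L / 2 \<le> (\<alpha> + 1) * real m"
    proof -
      have "L / 2 \<le> L - K" using L K1K by linarith
      also have "\<dots> \<le> \<alpha> * real m + real m" using lower dec lnm by linarith
      finally show ?thesis by (simp add: distrib_right)
    qed
    then have "L \<le> real m * (2 * (\<alpha> + 1))" by (simp add: field_simps)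
    then have "ln L \<le> ln (real m * (2 * (\<alpha> + 1)))" using Lpos m \<alpha> by (subst ln_le_cancel_iff) auto
    then have l2: "ln L \<le> ln (real m) + ln (2 * (\<alpha> + 1))" using m \<alpha> by (subst (asm) ln_mult_pos) auto
    have l3: "\<bar>ln (real m) - ln L\<bar> \<le> K2" using l1 l2 unfolding K2_def by linarith
    have "\<alpha> * (real m - (L / \<alpha> - ln L / (2 * \<alpha>))) = (decay_exponent m - L) - (ln (real m) - ln L) / 2"
      using \<alpha> by (simp add: dec field_simps)
    moreover have "\<bar>(decay_exponent m - L) - (ln (real m) - ln L) / 2\<bar> \<le> K1 + K2 / 2"
    proof (rule abs_leI)
      have l4: "ln (real m) - ln L \<le> K2" "ln L - ln (real m) \<le> K2"
        using l3 by (simp_all add: abs_le_iff)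
      show "(decay_exponent m - L) - (ln (real m) - ln L) / 2 \<le> K1 + K2 / 2"
        using upper l4(2) by argo
      show "- ((decay_exponent m - L) - (ln (real m) - ln L) / 2) \<le> K1 + K2 / 2"
        using lower l4(1) K1K by argo
    qed
    ultimately have "\<alpha> * \<bar>real m - (L / \<alpha> - ln L / (2 * \<alpha>))\<bar> \<le> K1 + K2 / 2"
      using \<alpha> by (metis abs_mult abs_of_pos)
    then show ?thesis using \<alpha> by (simp add: m_def L_def pos_le_divide_eq mult.commute)
  qed
  show ?thesis
    by (rule exI[of _ "(K1 + K2 / 2) / \<alpha>"], rule exI[of _ e])
       (use e main in \<open>auto simp: \<alpha>_def\<close>)
qed

lemma first_degree_asymp_equiv:
  assumes t: "t > 0"
  shows "(\<lambda>\<epsilon>. real (first_degree t \<epsilon>)) \<sim>[at_right 0] leading_degree"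
proof (rule smallo_imp_asymp_equiv)
  obtain C e where e: "e > 0" "\<And>\<epsilon>. 0 < \<epsilon> \<Longrightarrow> \<epsilon> < e \<Longrightarrow>
     \<bar>real (first_degree t \<epsilon>) - (log_tol \<epsilon> / arsinh 1 - ln (log_tol \<epsilon>) / (2 * arsinh 1))\<bar> \<le> C"
    using first_degree_expansion t by blast
  have ar: "arsinh (1::real) > 0" by (rule arsinh_1_pos)
  have asym: "(\<lambda>_. 1) \<in> o[at_right 0](\<lambda>\<epsilon>::real. ln (1 / \<epsilon>) / c)"
    "(\<lambda>\<epsilon>::real. ln (ln (1 / \<epsilon>)) / (2 * c)) \<in> o[at_right 0](\<lambda>\<epsilon>. ln (1 / \<epsilon>) / c)" if "c > 0" for c :: real
    using that by real_asymp+
  have "(\<lambda>\<epsilon>. real (first_degree t \<epsilon>) - (log_tol \<epsilon> / arsinh 1 - ln (log_tol \<epsilon>) / (2 * arsinh 1))) \<in> O[at_right 0](\<lambda>_. 1)"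
    by (rule bigoI[of _ C]) (use e in \<open>auto simp: eventually_at_right_field\<close>)
  also have "(\<lambda>_. 1) \<in> o[at_right 0](leading_degree)"
    unfolding leading_degree_def log_tol_def by (rule asym[OF ar])
  finally have 1: "(\<lambda>\<epsilon>. real (first_degree t \<epsilon>) - (log_tol \<epsilon> / arsinh 1 - ln (log_tol \<epsilon>) / (2 * arsinh 1))) \<in> o[at_right 0](leading_degree)" .
  have 2: "(\<lambda>\<epsilon>. ln (log_tol \<epsilon>) / (2 * arsinh 1)) \<in> o[at_right 0](leading_degree)"
    unfolding leading_degree_def log_tol_def by (rule asym[OF ar])
  show "(\<lambda>\<epsilon>. real (first_degree t \<epsilon>) - leading_degree \<epsilon>) \<in> o[at_right 0](leading_degree)"
    using sum_in_smallo(2)[OF 1 2] by (simp add: leading_degree_def)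
qed

theorem corollary6p2:
  shows "(\<forall>t>0. \<forall>\<epsilon>>0. \<exists>m\<ge>1. rat_error m t (opt_pole m t) \<le> \<epsilon>)
    \<and> ((\<lambda>(t, \<epsilon>). real (first_degree t \<epsilon>)
            - (log_tol \<epsilon> / arsinh 1 - ln (log_tol \<epsilon>) / (2 * arsinh 1)))
          \<in> O[small_tol_unif](\<lambda>_. 1))
    \<and> ((\<lambda>(t, \<epsilon>). opt_pole (first_degree t \<epsilon>) t
            - 1 / (sqrt 2 * t * arsinh 1) * (log_tol \<epsilon> - 1 / 2 * ln (log_tol \<epsilon>)))
          \<in> O[small_tol_unif](\<lambda>(t, \<epsilon>). 1 / t))
    \<and> (\<forall>t>0. (\<lambda>\<epsilon>. real (first_degree t \<epsilon>)) \<sim>[at_right 0] leading_degree)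
    \<and> (\<forall>\<epsilon>>0. leading_degree (\<epsilon> / 10) - leading_degree \<epsilon> = ln 10 / arsinh 1)
    \<and> (\<forall>t>0. (\<lambda>d. real (first_degree t (1 / 10 ^ d)) / real d)
                 \<longlonglongrightarrow> ln 10 / arsinh 1)
    \<and> (\<bar>ln 10 / arsinh 1 - 2.6125 :: real\<bar> < 0.00005)"
proof (intro conjI allI impI)
  have ar: "arsinh (1::real) > 0" by (rule arsinh_1_pos)
  obtain C e where e: "e > 0" "e < 1" and C: "\<And>t \<epsilon>. t > 0 \<Longrightarrow> 0 < \<epsilon> \<Longrightarrow> \<epsilon> < e \<Longrightarrow>
     \<bar>real (first_degree t \<epsilon>) - (log_tol \<epsilon> / arsinh 1 - ln (log_tol \<epsilon>) / (2 * arsinh 1))\<bar> \<le> C"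
    using first_degree_expansion by blast
  show "\<exists>m\<ge>1. rat_error m t (opt_pole m t) \<le> \<epsilon>" if "t > 0" "\<epsilon> > 0" for t \<epsilon>
    by (rule exists_degree[OF that])
  show "(\<lambda>(t, \<epsilon>). real (first_degree t \<epsilon>)
            - (log_tol \<epsilon> / arsinh 1 - ln (log_tol \<epsilon>) / (2 * arsinh 1)))
          \<in> O[small_tol_unif](\<lambda>_. 1)"
    by (rule bigoI[of _ C]) (use e C in \<open>auto simp: eventually_small_tol_unif\<close>)
  show "(\<lambda>(t, \<epsilon>). opt_pole (first_degree t \<epsilon>) t
            - 1 / (sqrt 2 * t * arsinh 1) * (log_tol \<epsilon> - 1 / 2 * ln (log_tol \<epsilon>)))
          \<in> O[small_tol_unif](\<lambda>(t, \<epsilon>). 1 / t)"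
  proof (rule bigoI[of _ "C / sqrt 2"], unfold eventually_small_tol_unif, intro exI[of _ e] conjI allI impI)
    fix t \<epsilon> :: real assume t: "t > 0" and \<epsilon>: "0 < \<epsilon> \<and> \<epsilon> < e"
    let ?D = "real (first_degree t \<epsilon>) - (log_tol \<epsilon> / arsinh 1 - ln (log_tol \<epsilon>) / (2 * arsinh 1))"
    have "opt_pole (first_degree t \<epsilon>) t - 1 / (sqrt 2 * t * arsinh 1) * (log_tol \<epsilon> - 1 / 2 * ln (log_tol \<epsilon>))
        = 1 / (sqrt 2 * t) * ?D"
      using t ar by (simp add: opt_pole_def field_simps)
    moreover have "\<bar>1 / (sqrt 2 * t) * ?D\<bar> \<le> 1 / (sqrt 2 * t) * C"
      unfolding abs_mult using C[of t \<epsilon>] t \<epsilon> by (intro mult_mono) auto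
    ultimately show "norm (case (t, \<epsilon>) of (t, \<epsilon>) \<Rightarrow> opt_pole (first_degree t \<epsilon>) t
            - 1 / (sqrt 2 * t * arsinh 1) * (log_tol \<epsilon> - 1 / 2 * ln (log_tol \<epsilon>)))
          \<le> C / sqrt 2 * norm (case (t, \<epsilon>) of (t, \<epsilon>) \<Rightarrow> 1 / t)"
      using t by simp
  qed (use e in auto)
  show equiv: "(\<lambda>\<epsilon>. real (first_degree t \<epsilon>)) \<sim>[at_right 0] leading_degree" if "t > 0" for t
    by (rule first_degree_asymp_equiv[OF that])
  show "leading_degree (\<epsilon> / 10) - leading_degree \<epsilon> = ln 10 / arsinh 1" if "\<epsilon> > 0" for \<epsilon>
    using that by (simp add: leading_degree_def log_tol_def ln_div ln_mult diff_divide_distrib)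
  show "(\<lambda>d. real (first_degree t (1 / 10 ^ d)) / real d) \<longlonglongrightarrow> ln 10 / arsinh 1" if t: "t > 0" for t
  proof -
    have "filterlim (\<lambda>d::nat. 1 / 10 ^ d :: real) (at_right 0) sequentially"
      by real_asymp
    then have "(\<lambda>d. real (first_degree t (1 / 10 ^ d))) \<sim>[sequentially] (\<lambda>d. leading_degree (1 / 10 ^ d))"
      by (rule asymp_equiv_compose'[OF equiv[OF t]])
    then have "((\<lambda>d. real (first_degree t (1 / 10 ^ d)) / leading_degree (1 / 10 ^ d)) \<longlongrightarrow> 1) sequentially"
    proof (rule asymp_equivD_strong)
      have "real (first_degree t (1 / 10 ^ d)) \<noteq> 0" for d
        using first_degree_props(1)[OF t, of "1 / 10 ^ d"] by simp
      then show "\<forall>\<^sub>F d in sequentially. real (first_degree t (1 / 10 ^ d)) \<noteq> 0 \<or> leading_degree (1 / 10 ^ d) \<noteq> 0"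
        by (intro always_eventually) auto
    qed
    then have "(\<lambda>d. real (first_degree t (1 / 10 ^ d)) / leading_degree (1 / 10 ^ d) * (ln 10 / arsinh 1)) \<longlonglongrightarrow> 1 * (ln 10 / arsinh 1)"
      by (intro tendsto_intros)
    moreover have "real (first_degree t (1 / 10 ^ d)) / leading_degree (1 / 10 ^ d) * (ln 10 / arsinh 1) = real (first_degree t (1 / 10 ^ d)) / real d" for d
      using ar by (simp add: leading_degree_def log_tol_def ln_realpow)
    ultimately show ?thesis by (simp only: mult_1)
  qed
  show "\<bar>ln 10 / arsinh 1 - 2.6125 :: real\<bar> < 0.00005"
    by (rule ln_10_over_arsinh_1)
qed

end
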